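(* Let $\varepsilon>0$, and consider the projection problem $\min\{\|x-x_0\|^2 : x\in\mathbb{R}^n,\ h_i(x)\le 0\ \forall i\in[m]\}$ under the assumptions listed in the context, together with its dual $\max_{\lambda\in\mathbb{R}^m,\lambda\ge0}d(\lambda)$. Run the Fast Projection Method described in the context with accuracy parameter $$\tilde\varepsilon=\frac{\varepsilon^4}{256\,(mRG)^6}$$ and number of rounds $T=O\!\left(\frac{m}{\theta}\log(mR/\varepsilon)\right)$. Then it outputs $\bar x$ such that, for all $x\in\mathcal{K}=\{x:\mathbf{h}(x)\le0\}$, $$\|\bar x-x_0\|^2\le \|x-x_0\|^2+6\varepsilon,\qquad\text{and}\qquad h_i(\bar x)\le\varepsilon\quad\forall i\in[m].$$ Moreover, the total running time of the method is $$O\!\left(n\,m^{2.5}\,\theta^{-1}\log^2(m/\varepsilon)+\tau_{\rm CP}(m)\,m\,\theta^{-1}\log(mR/\varepsilon)\right),$$ where $\theta$ is the rate of the cutting plane method used, and $\tau_{\rm CP}(m)$ is the extra running time required by the cutting plane method for updating the sets $M_t$ beyond calling the gradient and value oracles.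
   Context: **Notation.** $\|\cdot\|$ is the Euclidean norm, $[m]=\{1,\dots,m\}$, vector inequalities are elementwise, $\mathrm{Vol}$ is $m$-dimensional volume. **Assumptions.** $x_0\in\mathbb{R}^n$; $h_1,\dots,h_m:\mathbb{R}^n\to\mathbb{R}$ are convex; $\mathcal{K}=\{x: h_i(x)\le0\ \forall i\in[m]\}$ is compact; each $h_i$ is $L$-smooth, i.e. $\|\nabla h_i(x)-\nabla h_i(y)\|\le L\|x-y\|$ for all $x,y\in\mathbb{R}^n$; each $h_i$ is $G$-Lipschitz on the convex hull of $\mathcal{K}$ and $x_0$, i.e. $|h_i(x)-h_i(y)|\le G\|x-y\|$ for all $x,y\in\mathrm{Conv}\{\mathcal{K},x_0\}$; $H>0$ satisfies $\max_{x\in\mathcal{K}}|h_i(x)|\le H$ for all $i$; $B$ satisfies $\min_{x\in\mathcal{K}}\|x-x_0\|\le B$; Slater's condition holds (there is $x$ with $h_i(x)<0$ for all $i$). Put $\mathbf{h}=(h_1,\dots,h_m)$, $\mathcal{L}(x,\lambda)=\|x-x_0\|^2+\lambda^\top\mathbf{h}(x)$ for $\lambda\in\mathbb{R}^m$, $\lambda\ge0$, and $d(\lambda)=\min_{x\in\mathbb{R}^n}\mathcal{L}(x,\lambda)$. A number $R\ge1$ is known such that some maximizer $\lambda_*$ of $d$ over $\lambda\ge0$ satisfies $\|\lambda_*\|_\infty\le R$. Let $\mathcal{D}=[0,R]^m$. The constants $L,G$ are also known; $B,H$ need not be. Evaluating the value or gradient of one $h_i$ at one point costs $O(n)$. In the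 $O(\cdot)$ bounds, undisplayed factors depending only on $L,G,H,R,B$ are suppressed. **Oracles.** For $\lambda\ge0$ and $\tilde\varepsilon>0$, compute by Nesterov's accelerated gradient descent started at $x_0$, with strong convexity parameter $\alpha=2$, smoothness parameter $\beta=2+\|\lambda\|_1L$ and $O(\sqrt\beta\log(\beta B/\tilde\varepsilon))$ iterations, an $\tilde\varepsilon$-optimal solution $x_\lambda$ of $\min_x\mathcal{L}(x,\lambda)$. Set $\mathcal{O}_x(\lambda)=x_\lambda$, $\mathcal{O}_g(\lambda)=\mathbf{h}(x_\lambda)$, $\mathcal{O}_v(\lambda)=\mathcal{L}(x_\lambda,\lambda)$. (Accelerated gradient descent for $F$ with $\kappa=\beta/\alpha$: $y_0=x_0$, $y_{t+1}=x_t-\frac1\beta\nabla F(x_t)$, $x_{t+1}=\bigl(1+\tfrac{\sqrt\kappa-1}{\sqrt\kappa+1}\bigr)y_{t+1}-\tfrac{\sqrt\kappa-1}{\sqrt\kappa+1}y_t$; the output is the last $y_t$.) The separation oracle $\mathcal{O}_s(\lambda)\in\mathbb{R}^m$ has $i$-th coordinate $1$ if $\lambda^{(i)}>R$, $-1$ if $\lambda^{(i)}<0$, and $0$ otherwise. **Fast Projection Method (accuracy $\tilde\varepsilon$, $T$ rounds).** Start with $M_1=\mathcal{D}$ and $\lambda_1=(R/2,\dots,R/2)$. In round $t=1,\dots,T$: if $\lambda_t\in\mathcal{D}$ set $w_t=-\mathcal{O}_g(\lambda_t)$, otherwise set $w_t=\mathcal{O}_s(\lambda_t)$; construct $M_{t+1}$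 with $\{\lambda\in M_t: w_t^\top(\lambda-\lambda_t)\le0\}\subseteq M_{t+1}$ and choose $\lambda_{t+1}\in M_{t+1}$. Output $\bar\lambda\in\arg\max\{\mathcal{O}_v(\lambda):\lambda\in\{\lambda_1,\dots,\lambda_T\}\cap\mathcal{D}\}$ and $\bar x=\mathcal{O}_x(\bar\lambda)$. The rule for constructing $M_{t+1}$ and choosing $\lambda_{t+1}$ is the "cutting plane method"; it has rate $\theta>0$ if $\mathrm{Vol}(M_{t+1})/\mathrm{Vol}(M_1)\le e^{-\theta t}$ for all $t$.
   Formalization: Logarithms in the O-bounds are read as max(1, log), and the hidden constants may also depend on an arbitrary upper bound E for ε (and on the O(n) cost constant); as written, log(mR/ε) vanishes at ε = mR, giving no rounds and no output. *)

theory Defs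
  imports "HOL-Analysis.Analysis" "HOL-Library.Poly_Mapping"
begin

section \<open>Coordinate spaces with the dimension as a term\<close>

text \<open>
  The constants hidden in the O-bounds must not depend on the dimensions \<open>n\<close> and \<open>m\<close>, so the
  dimensions are quantified after these constants and cannot be types.  All the spaces \<open>R^n\<close> live
  inside one inner product space, the finitely supported families with the Euclidean inner
  product; \<open>R^n\<close> is the subspace of families supported on the indices \<open>0, \<dots>, n - 1\<close>.  Restricted to
  it, norm, topology, convexity, compactness and derivatives are the usual ones.

  Caution: the (lexicographic) order and the (convolution) product that the library provides on
  finitely supported families play no role; inequalities between vectors are always written out
  coordinatewise.
\<close>

unbundle inner_syntax

instantiation poly_mapping :: (type, real_inner) real_inner
begin

lift_definition scaleR_poly_mapping :: "real \<Rightarrow> ('a \<Rightarrow>\<^sub>0 'b) \<Rightarrow> 'a \<Rightarrow>\<^sub>0 'b"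
  is "\<lambda>c f k. c *\<^sub>R f k"
  by (rule finite_subset) auto

definition inner_poly_mapping :: "('a \<Rightarrow>\<^sub>0 'b) \<Rightarrow> ('a \<Rightarrow>\<^sub>0 'b) \<Rightarrow> real" where
  "inner_poly_mapping x y =
     (\<Sum>k\<in>Poly_Mapping.keys x. Poly_Mapping.lookup x k \<bullet> Poly_Mapping.lookup y k)"

definition norm_poly_mapping :: "('a \<Rightarrow>\<^sub>0 'b) \<Rightarrow> real" where
  "norm_poly_mapping x = sqrt (x \<bullet> x)"

definition dist_poly_mapping :: "('a \<Rightarrow>\<^sub>0 'b) \<Rightarrow> ('a \<Rightarrow>\<^sub>0 'b) \<Rightarrow> real" where
  "dist_poly_mapping x y = norm (x - y)"

definition sgn_poly_mapping :: "('a \<Rightarrow>\<^sub>0 'b) \<Rightarrow> 'a \<Rightarrow>\<^sub>0 'b" where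
  "sgn_poly_mapping x = inverse (norm x) *\<^sub>R x"

definition uniformity_poly_mapping :: "(('a \<Rightarrow>\<^sub>0 'b) \<times> ('a \<Rightarrow>\<^sub>0 'b)) filter" where
  "uniformity_poly_mapping = (INF e\<in>{0<..}. principal {(x, y). dist x y < e})"

definition open_poly_mapping :: "('a \<Rightarrow>\<^sub>0 'b) set \<Rightarrow> bool" where
  "open_poly_mapping U \<longleftrightarrow> (\<forall>x\<in>U. eventually (\<lambda>(x', y). x' = x \<longrightarrow> y \<in> U) uniformity)"

lemma inner_poly_mapping_superset:
  assumes "finite A" "Poly_Mapping.keys x \<subseteq> A"
  shows "x \<bullet> y = (\<Sum>k\<in>A. Poly_Mapping.lookup x k \<bullet> Poly_Mapping.lookup y k)"
  unfolding inner_poly_mapping_def using assms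
  by (intro sum.mono_neutral_left) (auto simp: in_keys_iff)

instance
proof
  fix x y z :: "'a \<Rightarrow>\<^sub>0 'b" and r s :: real
  show "r *\<^sub>R (x + y) = r *\<^sub>R x + r *\<^sub>R y"
    by transfer (simp add: scaleR_add_right)
  show "(r + s) *\<^sub>R x = r *\<^sub>R x + s *\<^sub>R x"
    by transfer (simp add: scaleR_add_left)
  show "r *\<^sub>R s *\<^sub>R x = (r * s) *\<^sub>R x"
    by transfer simp
  show "1 *\<^sub>R x = x"
    by transfer simp
  show "sgn x = inverse (norm x) *\<^sub>R x"
    by (simp add: sgn_poly_mapping_def)
  show "dist x y = norm (x - y)"
    by (simp add: dist_poly_mapping_def)
  show "(uniformity :: (('a \<Rightarrow>\<^sub>0 'b) \<times> ('a \<Rightarrow>\<^sub>0 'b)) filter) =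
        (INF e\<in>{0<..}. principal {(x, y). dist x y < e})"
    by (simp add: uniformity_poly_mapping_def)
  show "open U \<longleftrightarrow> (\<forall>x\<in>U. eventually (\<lambda>(x', y). x' = x \<longrightarrow> y \<in> U) uniformity)"
    for U :: "('a \<Rightarrow>\<^sub>0 'b) set"
    by (simp add: open_poly_mapping_def)
  let ?A = "Poly_Mapping.keys x \<union> Poly_Mapping.keys y"
  have A: "finite ?A" by simp
  show "x \<bullet> y = y \<bullet> x"
    by (simp add: inner_poly_mapping_superset[of ?A x y] inner_poly_mapping_superset[of ?A y x]
        inner_commute)
  have "Poly_Mapping.keys (x + y) \<subseteq> ?A" by (rule Poly_Mapping.keys_add)
  then show "(x + y) \<bullet> z = x \<bullet> z + y \<bullet> z"
    by (simp add: inner_poly_mapping_superset[of ?A "x + y"] inner_poly_mapping_superset[of ?A x]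
        inner_poly_mapping_superset[of ?A y] lookup_add inner_add_left sum.distrib)
  have "Poly_Mapping.keys (r *\<^sub>R x) \<subseteq> Poly_Mapping.keys x"
    by (auto simp: in_keys_iff scaleR_poly_mapping.rep_eq)
  then show "(r *\<^sub>R x) \<bullet> y = r * (x \<bullet> y)"
    by (simp add: inner_poly_mapping_superset[of "Poly_Mapping.keys x"] scaleR_poly_mapping.rep_eq
        sum_distrib_left)
  show "0 \<le> x \<bullet> x"
    by (simp add: inner_poly_mapping_def sum_nonneg)
  show "x \<bullet> x = 0 \<longleftrightarrow> x = 0"
    by (simp add: inner_poly_mapping_def sum_nonneg_eq_0_iff poly_mapping_eq_iff fun_eq_iff)
      (metis in_keys_iff)
  show "norm x = sqrt (x \<bullet> x)"
    by (simp add: norm_poly_mapping_def)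
qed

end

type_synonym vec = "nat \<Rightarrow>\<^sub>0 real"

abbreviation coord :: "vec \<Rightarrow> nat \<Rightarrow> real"  (infixl \<open>\<cdot>\<close> 95) where
  "x \<cdot> i \<equiv> Poly_Mapping.lookup x i"

definition Rn :: "nat \<Rightarrow> vec set" where
  "Rn n = {x. \<forall>i\<ge>n. x \<cdot> i = 0}"

definition mk_vec :: "nat \<Rightarrow> (nat \<Rightarrow> real) \<Rightarrow> vec" where
  "mk_vec n f = (\<Sum>i<n. Poly_Mapping.single i (f i))"

definition grad :: "nat \<Rightarrow> (vec \<Rightarrow> real) \<Rightarrow> vec \<Rightarrow> vec" where
  "grad n f x = (THE g. g \<in> Rn n \<and> (f has_derivative (\<lambda>v. g \<bullet> v)) (at x within Rn n))"

text \<open>Lebesgue measure on \<open>R^m\<close>, via the product measure on functions on the index set.\<close>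

definition lebesgue_Rn :: "nat \<Rightarrow> (nat \<Rightarrow> real) measure" where
  "lebesgue_Rn m = completion (\<Pi>\<^sub>M i\<in>{..<m}. lborel)"

definition coords :: "nat \<Rightarrow> vec set \<Rightarrow> (nat \<Rightarrow> real) set" where
  "coords m S = (\<lambda>x. restrict (Poly_Mapping.lookup x) {..<m}) ` S"

definition measurable_Rn :: "nat \<Rightarrow> vec set \<Rightarrow> bool" where
  "measurable_Rn m S \<longleftrightarrow> S \<subseteq> Rn m \<and> coords m S \<in> sets (lebesgue_Rn m)"

definition Vol :: "nat \<Rightarrow> vec set \<Rightarrow> ennreal" where
  "Vol m S = emeasure (lebesgue_Rn m) (coords m S)"


section \<open>The projection problem and its dual\<close>

text \<open>The constraints are \<open>h 0, \<dots>, h (m - 1)\<close>; only their values on \<open>Rn n\<close> matter.\<close>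

definition feasible :: "nat \<Rightarrow> nat \<Rightarrow> (nat \<Rightarrow> vec \<Rightarrow> real) \<Rightarrow> vec set" where
  "feasible n m h = {x \<in> Rn n. \<forall>i<m. h i x \<le> 0}"

definition nonneg :: "nat \<Rightarrow> vec set" where
  "nonneg m = {l \<in> Rn m. \<forall>i<m. 0 \<le> l \<cdot> i}"

definition box :: "nat \<Rightarrow> real \<Rightarrow> vec set" where
  "box m R = {l \<in> Rn m. \<forall>i<m. 0 \<le> l \<cdot> i \<and> l \<cdot> i \<le> R}"

definition lagr :: "nat \<Rightarrow> vec \<Rightarrow> (nat \<Rightarrow> vec \<Rightarrow> real) \<Rightarrow> vec \<Rightarrow> vec \<Rightarrow> real" where
  "lagr m x0 h x l = (norm (x - x0))\<^sup>2 + (\<Sum>i<m. l \<cdot> i * h i x)"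

text \<open>For convex \<open>h i\<close> and nonnegative multipliers the infimum is attained.\<close>

definition dual :: "nat \<Rightarrow> nat \<Rightarrow> vec \<Rightarrow> (nat \<Rightarrow> vec \<Rightarrow> real) \<Rightarrow> vec \<Rightarrow> real" where
  "dual n m x0 h l = (INF x\<in>Rn n. lagr m x0 h x l)"

definition dual_maximizer :: "nat \<Rightarrow> nat \<Rightarrow> vec \<Rightarrow> (nat \<Rightarrow> vec \<Rightarrow> real) \<Rightarrow> vec \<Rightarrow> bool" where
  "dual_maximizer n m x0 h l \<longleftrightarrow> is_arg_max (dual n m x0 h) (\<lambda>l. l \<in> nonneg m) l"

definition projection_problem ::
  "nat \<Rightarrow> nat \<Rightarrow> vec \<Rightarrow> (nat \<Rightarrow> vec \<Rightarrow> real) \<Rightarrow> real \<Rightarrow> real \<Rightarrow> real \<Rightarrow> real \<Rightarrow> real \<Rightarrow> bool" where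
  "projection_problem n m x0 h L G H R B \<longleftrightarrow>
     1 \<le> n \<and> 1 \<le> m \<and> x0 \<in> Rn n \<and>
     (\<forall>i<m. convex_on (Rn n) (h i)) \<and>
     compact (feasible n m h) \<and>
     (\<forall>i<m. h i differentiable_on Rn n \<and> L-lipschitz_on (Rn n) (grad n (h i))) \<and>
     (\<forall>i<m. G-lipschitz_on (convex hull (insert x0 (feasible n m h))) (h i)) \<and>
     (\<forall>i<m. \<forall>x\<in>feasible n m h. \<bar>h i x\<bar> \<le> H) \<and>
     (\<exists>x\<in>feasible n m h. norm (x - x0) \<le> B) \<and>
     (\<exists>x\<in>Rn n. \<forall>i<m. h i x < 0) \<and>
     (\<exists>l. dual_maximizer n m x0 h l \<and> (\<forall>i<m. \<bar>l \<cdot> i\<bar> \<le> R))"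


section \<open>Accelerated gradient descent and the oracles\<close>

text \<open>The pair is \<open>(y\<^sub>t, x\<^sub>t)\<close>.\<close>

fun agd :: "(vec \<Rightarrow> vec) \<Rightarrow> real \<Rightarrow> real \<Rightarrow> vec \<Rightarrow> nat \<Rightarrow> vec \<times> vec" where
  "agd dF \<alpha> \<beta> x0 0 = (x0, x0)"
| "agd dF \<alpha> \<beta> x0 (Suc t) =
     (let (y, x) = agd dF \<alpha> \<beta> x0 t;
          q = (sqrt (\<beta> / \<alpha>) - 1) / (sqrt (\<beta> / \<alpha>) + 1);
          y' = x - (1 / \<beta>) *\<^sub>R dF x
      in (y', (1 + q) *\<^sub>R y' - q *\<^sub>R y))"

text \<open>
  O-bounds with logarithms are read with \<open>max 1 (ln _)\<close> in place of the logarithm, which could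
  otherwise be zero or negative, and as asymptotic bounds for small accuracies: the hidden
  constants may depend on an arbitrary upper bound \<open>E\<close> for the accuracy \<open>\<epsilon>\<close>.  (For \<open>\<epsilon>\<close> of the
  order of \<open>m * R\<close> the number of rounds would be of order \<open>m / \<theta>\<close>, which is too small.)
\<close>

definition logO :: "real \<Rightarrow> real" where
  "logO x = max 1 (ln x)"

definition smoothness :: "nat \<Rightarrow> real \<Rightarrow> vec \<Rightarrow> real" where
  "smoothness m L l = 2 + (\<Sum>i<m. \<bar>l \<cdot> i\<bar>) * L"

definition agd_iters :: "real \<Rightarrow> nat \<Rightarrow> real \<Rightarrow> real \<Rightarrow> real \<Rightarrow> vec \<Rightarrow> nat" where
  "agd_iters c m L B e l =
     nat \<lceil>c * sqrt (smoothness m L l) * logO (smoothness m L l * B / e)\<rceil>"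

text \<open>In the oracles, \<open>N\<close> gives the number of iterations for each multiplier.\<close>

definition agd_lagr ::
  "nat \<Rightarrow> nat \<Rightarrow> vec \<Rightarrow> (nat \<Rightarrow> vec \<Rightarrow> real) \<Rightarrow> real \<Rightarrow> vec \<Rightarrow> nat \<Rightarrow> vec \<times> vec" where
  "agd_lagr n m x0 h L l t =
     agd (grad n (\<lambda>x. lagr m x0 h x l)) 2 (smoothness m L l) x0 t"

definition oracle_x ::
  "nat \<Rightarrow> nat \<Rightarrow> vec \<Rightarrow> (nat \<Rightarrow> vec \<Rightarrow> real) \<Rightarrow> real \<Rightarrow> (vec \<Rightarrow> nat) \<Rightarrow> vec \<Rightarrow> vec" where
  "oracle_x n m x0 h L N l = fst (agd_lagr n m x0 h L l (N l))"

definition oracle_g ::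
  "nat \<Rightarrow> nat \<Rightarrow> vec \<Rightarrow> (nat \<Rightarrow> vec \<Rightarrow> real) \<Rightarrow> real \<Rightarrow> (vec \<Rightarrow> nat) \<Rightarrow> vec \<Rightarrow> vec" where
  "oracle_g n m x0 h L N l = mk_vec m (\<lambda>i. h i (oracle_x n m x0 h L N l))"

definition oracle_v ::
  "nat \<Rightarrow> nat \<Rightarrow> vec \<Rightarrow> (nat \<Rightarrow> vec \<Rightarrow> real) \<Rightarrow> real \<Rightarrow> (vec \<Rightarrow> nat) \<Rightarrow> vec \<Rightarrow> real" where
  "oracle_v n m x0 h L N l = lagr m x0 h (oracle_x n m x0 h L N l) l"

definition oracle_s :: "nat \<Rightarrow> real \<Rightarrow> vec \<Rightarrow> vec" where
  "oracle_s m R l = mk_vec m (\<lambda>i. if l \<cdot> i > R then 1 else if l \<cdot> i < 0 then -1 else 0)"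

definition approx_minimizer ::
  "nat \<Rightarrow> nat \<Rightarrow> vec \<Rightarrow> (nat \<Rightarrow> vec \<Rightarrow> real) \<Rightarrow> real \<Rightarrow> vec \<Rightarrow> vec \<Rightarrow> bool" where
  "approx_minimizer n m x0 h e l x \<longleftrightarrow>
     x \<in> Rn n \<and> (\<forall>z\<in>Rn n. lagr m x0 h x l \<le> lagr m x0 h z l + e)"


section \<open>The Fast Projection Method\<close>

definition fpm_cut ::
  "nat \<Rightarrow> nat \<Rightarrow> vec \<Rightarrow> (nat \<Rightarrow> vec \<Rightarrow> real) \<Rightarrow> real \<Rightarrow> real \<Rightarrow> (vec \<Rightarrow> nat) \<Rightarrow> vec \<Rightarrow> vec" where
  "fpm_cut n m x0 h L R N l =
     (if l \<in> box m R then - oracle_g n m x0 h L N l else oracle_s m R l)"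

text \<open>
  \<open>M 1, \<dots>, M (T + 1)\<close> and \<open>lam 1, \<dots>, lam (T + 1)\<close> are produced by the method from the cuts \<open>w\<close>
  with some cutting plane rule.
\<close>

definition fpm_run ::
  "nat \<Rightarrow> real \<Rightarrow> (vec \<Rightarrow> vec) \<Rightarrow> nat \<Rightarrow> (nat \<Rightarrow> vec set) \<Rightarrow> (nat \<Rightarrow> vec) \<Rightarrow> bool" where
  "fpm_run m R w T M lam \<longleftrightarrow>
     M 1 = box m R \<and> lam 1 = mk_vec m (\<lambda>_. R / 2) \<and>
     (\<forall>t\<in>{1..T}.
        measurable_Rn m (M (t + 1)) \<and>
        {l \<in> M t. w (lam t) \<bullet> (l - lam t) \<le> 0} \<subseteq> M (t + 1) \<and>
        lam (t + 1) \<in> M (t + 1))"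

text \<open>
  A zero cut excludes nothing, so then \<open>M t\<close> is contained in \<open>M (t + 1)\<close>; volume decrease is
  therefore required only as long as all cuts were nonzero.  The bound \<open>\<theta> \<le> ln 2\<close> restricts
  nothing if the first cut is nonzero: this cut goes through the centre of the box, hence
  \<open>Vol (M 2)\<close> is at least half of \<open>Vol (M 1)\<close>.
\<close>

definition cp_rate ::
  "nat \<Rightarrow> (vec \<Rightarrow> vec) \<Rightarrow> nat \<Rightarrow> (nat \<Rightarrow> vec set) \<Rightarrow> (nat \<Rightarrow> vec) \<Rightarrow> real \<Rightarrow> bool" where
  "cp_rate m w T M lam \<theta> \<longleftrightarrow>
     0 < \<theta> \<and> \<theta> \<le> ln 2 \<and>
     (\<forall>t\<in>{1..T}. (\<forall>s\<in>{1..t}. w (lam s) \<noteq> 0) \<longrightarrow>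
        Vol m (M (t + 1)) \<le> ennreal (exp (- \<theta> * real t)) * Vol m (M 1))"

definition fpm_output ::
  "nat \<Rightarrow> real \<Rightarrow> (vec \<Rightarrow> real) \<Rightarrow> nat \<Rightarrow> (nat \<Rightarrow> vec) \<Rightarrow> vec \<Rightarrow> bool" where
  "fpm_output m R v T lam lbar \<longleftrightarrow> is_arg_max v (\<lambda>l. l \<in> lam ` {1..T} \<inter> box m R) lbar"


section \<open>Running time\<close>

text \<open>
  Unit-cost real arithmetic (including \<open>sqrt\<close> and \<open>ln\<close>); evaluating \<open>h i\<close> and its gradient at \<open>x\<close>
  costs \<open>cv i x\<close> and \<open>cg i x\<close>.
\<close>

definition eval_cost ::
  "nat \<Rightarrow> nat \<Rightarrow> real \<Rightarrow> (nat \<Rightarrow> vec \<Rightarrow> real) \<Rightarrow> (nat \<Rightarrow> vec \<Rightarrow> real) \<Rightarrow> bool" where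
  "eval_cost n m c cv cg \<longleftrightarrow>
     (\<forall>i<m. \<forall>x\<in>Rn n. 0 \<le> cv i x \<and> cv i x \<le> c * n \<and> 0 \<le> cg i x \<and> cg i x \<le> c * n)"

text \<open>
  The Lagrangian's gradient is evaluated as \<open>2 (x - x0) + (\<Sum>i<m. l \<cdot> i * grad (h i) x)\<close>, with \<open>2 n\<close>
  operations for the first term and \<open>2 n\<close> for multiplying and adding each further one.
\<close>

definition lagr_grad_time :: "nat \<Rightarrow> nat \<Rightarrow> (nat \<Rightarrow> vec \<Rightarrow> real) \<Rightarrow> vec \<Rightarrow> real" where
  "lagr_grad_time n m cg x = 2 * n + (\<Sum>i<m. cg i x + 2 * n)"

text \<open>
  Each iteration evaluates one gradient, at the point \<open>x\<^sub>t\<close>, and forms the two linear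
  combinations with \<open>5 n\<close> operations; computing the \<open>1\<close>-norm of the multiplier takes \<open>2 m\<close>
  operations, and a constant number suffices for the remaining parameters.
\<close>

definition oracle_x_time ::
  "nat \<Rightarrow> nat \<Rightarrow> vec \<Rightarrow> (nat \<Rightarrow> vec \<Rightarrow> real) \<Rightarrow> real \<Rightarrow> (vec \<Rightarrow> nat) \<Rightarrow>
     (nat \<Rightarrow> vec \<Rightarrow> real) \<Rightarrow> vec \<Rightarrow> real" where
  "oracle_x_time n m x0 h L N cg l =
     2 * m + 20 +
     (\<Sum>t<N l. lagr_grad_time n m cg (snd (agd_lagr n m x0 h L l t)) + 5 * n)"

text \<open>
  Per round: \<open>2 m\<close> comparisons to test membership in the box; for points in it one call of
  \<open>oracle_x\<close>, the \<open>m\<close> constraint values, \<open>m\<close> sign changes for the cut, \<open>3 n + 2 m\<close> operations for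
  the value and one comparison with the best value so far; otherwise \<open>m\<close> assignments for the
  separating cut; finally \<open>u t\<close>, the cost of the cutting plane update.  The output takes one more
  call of \<open>oracle_x\<close>.
\<close>

definition fpm_time ::
  "nat \<Rightarrow> nat \<Rightarrow> vec \<Rightarrow> (nat \<Rightarrow> vec \<Rightarrow> real) \<Rightarrow> real \<Rightarrow> real \<Rightarrow> (vec \<Rightarrow> nat) \<Rightarrow>
     (nat \<Rightarrow> vec \<Rightarrow> real) \<Rightarrow> (nat \<Rightarrow> vec \<Rightarrow> real) \<Rightarrow> nat \<Rightarrow> (nat \<Rightarrow> vec) \<Rightarrow> (nat \<Rightarrow> real) \<Rightarrow> vec \<Rightarrow> real" where
  "fpm_time n m x0 h L R N cv cg T lam u lbar =
     m +
     (\<Sum>t=1..T. 2 * m +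
        (if lam t \<in> box m R
         then oracle_x_time n m x0 h L N cg (lam t)
              + (\<Sum>i<m. cv i (oracle_x n m x0 h L N (lam t))) + m + (3 * n + 2 * m) + 1
         else m)
        + u t)
     + oracle_x_time n m x0 h L N cg lbar"

end

theory Submission
  imports Defs
begin

text \<open>
  Accelerated gradient descent needs \<open>O(sqrt \<beta> log(1 / \<eta>))\<close> iterations for accuracy \<open>\<eta>\<close>: the initial
  gap is controlled by the gradient of the Lagrangian at \<open>x0\<close>, and Slater's condition turns the
  Lipschitz bound on the hull into the bound \<open>G\<close> for the gradients of the constraints there.
  The cutting plane method maximizes the dual up to \<open>2 \<eta>\<close>, because the box shrunk towards a
  maximizer no longer fits into the last set.  Since the Lagrangian is strongly convex, a dual gap
  of \<open>2 \<eta>\<close> and an oracle error of \<open>\<eta>\<close> put the output within \<open>sqrt (6 \<eta>)\<close> of the projection, which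
  is a minimizer of the Lagrangian at a dual maximizer.

  For large \<open>\<epsilon>\<close> the prescribed accuracy \<open>\<epsilon> ^ 4 / (256 * (m * R * G) ^ 6)\<close> is too weak for the guarantee.
  Hence the hidden constants are chosen such that the oracles are accurate up to \<open>\<eta>\<close>, this number
  times a small constant that depends on \<open>E\<close>.
\<close>

section \<open>Coordinate spaces and gradients\<close>

text \<open>The hidden constants are fixed before \<open>n\<close>, \<open>m\<close>,
  \<open>x0\<close> and \<open>h\<close>, so every loss is brought to the form of a power of
  \<open>m / \<epsilon>\<close> times a dimension-free factor: a multiple of the logarithm pays for
  the power, an absolute logarithm for the factor. The oracle must be accurate at all nonnegative
  multipliers, however large, where the distance from \<open>x0\<close> to the minimizer is not
  controlled by \<open>B\<close>. With \<open>S\<close> the sum of the multipliers, the gradient at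
  \<open>x0\<close> bounds the initial gap by \<open>(S * G)\<^sup>2\<close>. Since
  \<open>S * L \<le> \<beta>\<close>, this is at most of order \<open>\<beta>\<^sup>2\<close> for
  positive \<open>L\<close>, and twice the logarithm of \<open>\<beta> * B / e\<close> pays for it.
  Existence, stability and accuracy of minimizers all come from one midpoint inequality,
  \<open>near_minimizers_close\<close>, which speaks about arbitrary points and the infimum only.
  Duality is obtained by differentiating the dual at the given maximizer: unit directions yield
  feasibility of the Lagrangian's minimizer, the direction towards 0 yields complementary
  slackness.\<close>

lemma lookup_scaleR [simp]: "Poly_Mapping.lookup (c *\<^sub>R x) i = c *\<^sub>R Poly_Mapping.lookup x i"
  by (simp add: scaleR_poly_mapping.rep_eq)

lemma subspace_Rn: "subspace (Rn n)"
  by (auto simp: subspace_def Rn_def lookup_add)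

lemmas Rn_intros = subspace_add[OF subspace_Rn] subspace_diff[OF subspace_Rn]
  subspace_scale[OF subspace_Rn] subspace_0[OF subspace_Rn] subspace_sum[OF subspace_Rn]
  subspace_neg[OF subspace_Rn]

lemma convex_Rn: "convex (Rn n)"
  by (rule subspace_imp_convex[OF subspace_Rn])

lemma lookup_mk_vec: "mk_vec n f \<cdot> i = (if i < n then f i else 0)"
proof -
  have "mk_vec n f \<cdot> i = (\<Sum>k<n. if k = i then f k else 0)"
    unfolding mk_vec_def lookup_sum lookup_single by (intro sum.cong) (auto simp: when_def)
  then show ?thesis by simp
qed

lemma mk_vec_in_Rn: "mk_vec n f \<in> Rn n"
  by (simp add: Rn_def lookup_mk_vec)

lemma vec_eqI:
  assumes "x \<in> Rn n" "y \<in> Rn n" "\<And>i. i < n \<Longrightarrow> x \<cdot> i = y \<cdot> i"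
  shows "x = y"
  using assms by (intro poly_mapping_eqI) (metis (mono_tags, lifting) Rn_def linorder_not_le mem_Collect_eq)

lemma mk_vec_lookup: "x \<in> Rn n \<Longrightarrow> mk_vec n (Poly_Mapping.lookup x) = x"
  by (rule vec_eqI[OF mk_vec_in_Rn]) (simp_all add: lookup_mk_vec)

lemma Rn_expansion: "x \<in> Rn n \<Longrightarrow> x = (\<Sum>i<n. x \<cdot> i *\<^sub>R Poly_Mapping.single i 1)"
proof -
  assume "x \<in> Rn n"
  have "x \<cdot> i *\<^sub>R Poly_Mapping.single i (1::real) = Poly_Mapping.single i (x \<cdot> i)" for i
    by (rule poly_mapping_eqI) (simp add: lookup_single when_def)
  then show ?thesis using mk_vec_lookup[OF \<open>x \<in> Rn n\<close>] by (simp add: mk_vec_def)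
qed

lemma single_in_Rn: "i < n \<Longrightarrow> Poly_Mapping.single i c \<in> Rn n"
  by (auto simp: Rn_def lookup_single when_def)

lemma inner_Rn:
  assumes "x \<in> Rn n" shows "x \<bullet> y = (\<Sum>i<n. x \<cdot> i * y \<cdot> i)"
proof -
  have "Poly_Mapping.keys x \<subseteq> {..<n}"
    using assms by (auto simp: Rn_def in_keys_iff linorder_not_le[symmetric])
  then show ?thesis by (subst inner_poly_mapping_superset[of "{..<n}"]) auto
qed

lemma inner_single: "Poly_Mapping.single i (1::real) \<bullet> y = y \<cdot> i"
  by (subst inner_poly_mapping_superset[of "{i}"]) auto

lemma norm_single: "norm (Poly_Mapping.single (i::nat) (1::real)) = 1"
  by (subst norm_eq_sqrt_inner, subst inner_single) simp

lemma abs_coord_le_norm: "\<bar>x \<cdot> i\<bar> \<le> norm (x::vec)"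
  using Cauchy_Schwarz_ineq2[of "Poly_Mapping.single i 1" x] by (simp add: inner_single norm_single)

lemma norm_le_sum_coord:
  assumes "x \<in> Rn n" shows "norm x \<le> (\<Sum>i<n. \<bar>x \<cdot> i\<bar>)"
proof -
  have "norm (\<Sum>i<n. x \<cdot> i *\<^sub>R Poly_Mapping.single i (1::real)) \<le> (\<Sum>i<n. \<bar>x \<cdot> i\<bar>)"
    by (rule order_trans[OF norm_sum]) (simp add: norm_single)
  then show ?thesis using Rn_expansion[OF assms] by simp
qed

text \<open>The space of all finitely supported families is not complete, but its subspaces
  \<open>Rn n\<close> are. This provides the limits of minimizing sequences.\<close>

lemma complete_Rn: "complete (Rn n)"
proof (rule completeI)
  fix X :: "nat \<Rightarrow> vec" assume X: "\<forall>k. X k \<in> Rn n" and C: "Cauchy X"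
  have "Cauchy (\<lambda>k. X k \<cdot> i)" for i
  proof (rule CauchyI)
    fix e :: real assume "0 < e"
    then obtain M where M: "\<forall>a\<ge>M. \<forall>b\<ge>M. norm (X a - X b) < e" using CauchyD[OF C] by blast
    have "norm (X a \<cdot> i - X b \<cdot> i) \<le> norm (X a - X b)" for a b
      using abs_coord_le_norm[of "X a - X b" i] by (simp add: lookup_minus)
    then show "\<exists>M. \<forall>a\<ge>M. \<forall>b\<ge>M. norm (X a \<cdot> i - X b \<cdot> i) < e"
      using M by (meson order_le_less_trans)
  qed
  then have lim: "(\<lambda>k. X k \<cdot> i) \<longlonglongrightarrow> lim (\<lambda>k. X k \<cdot> i)" for i
    using Cauchy_convergent_iff convergent_LIMSEQ_iff by blast
  define l where "l = mk_vec n (\<lambda>i. lim (\<lambda>k. X k \<cdot> i))"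
  have l: "l \<in> Rn n" by (simp add: l_def mk_vec_in_Rn)
  have "(\<lambda>k. \<Sum>i<n. \<bar>X k \<cdot> i - l \<cdot> i\<bar>) \<longlonglongrightarrow> (\<Sum>i<n. \<bar>l \<cdot> i - l \<cdot> i\<bar>)"
    by (intro tendsto_sum tendsto_rabs tendsto_diff tendsto_const) (auto simp: l_def lookup_mk_vec lim)
  then have s: "(\<lambda>k. \<Sum>i<n. \<bar>X k \<cdot> i - l \<cdot> i\<bar>) \<longlonglongrightarrow> 0" by simp
  have "X \<longlonglongrightarrow> l"
  proof (subst LIM_zero_iff[symmetric], rule Lim_null_comparison[OF _ s], rule always_eventually, rule allI)
    show "norm (X k - l) \<le> (\<Sum>i<n. \<bar>X k \<cdot> i - l \<cdot> i\<bar>)" for k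
      using norm_le_sum_coord[of "X k - l" n] X l by (simp add: lookup_minus Rn_intros)
  qed
  with l show "\<exists>l\<in>Rn n. X \<longlonglongrightarrow> l" by blast
qed

section \<open>Gradients within \<open>Rn n\<close>, tangent and quadratic bounds\<close>

lemma has_derivative_line:
  assumes "y + t *\<^sub>R d \<in> Rn n" "d \<in> Rn n" "(f has_derivative (\<lambda>v. g \<bullet> v)) (at (y + t *\<^sub>R d) within Rn n)"
  shows "((\<lambda>t. f (y + t *\<^sub>R d)) has_real_derivative g \<bullet> d) (at t)"
proof -
  have y: "y \<in> Rn n"
    using subspace_diff[OF subspace_Rn assms(1), of "t *\<^sub>R d"] assms(2) by (simp add: Rn_intros)
  have "((\<lambda>t. y + t *\<^sub>R d) has_derivative (\<lambda>s. s *\<^sub>R d)) (at t)"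
    by (auto intro!: derivative_eq_intros)
  moreover have "(f has_derivative (\<lambda>v. g \<bullet> v)) (at (y + t *\<^sub>R d) within range (\<lambda>t. y + t *\<^sub>R d))"
    by (rule has_derivative_subset[OF assms(3)]) (auto intro!: Rn_intros y assms(2))
  ultimately have "((\<lambda>t. f (y + t *\<^sub>R d)) has_derivative (\<lambda>s. g \<bullet> (s *\<^sub>R d))) (at t)"
    by (rule has_derivative_in_compose)
  then show ?thesis
    by (rule has_derivative_imp_has_field_derivative) simp
qed

text \<open>The derivative within \<open>Rn n\<close> only sees directions in \<open>Rn n\<close>.
  As both candidates lie there, \<open>g - g'\<close> is such a direction, and equal slopes along it
  make its norm zero.\<close>

lemma has_derivative_Rn_unique:
  assumes "x \<in> Rn n" "g \<in> Rn n" "g' \<in> Rn n"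
    and "(f has_derivative (\<lambda>v. g \<bullet> v)) (at x within Rn n)"
    and "(f has_derivative (\<lambda>v. g' \<bullet> v)) (at x within Rn n)"
  shows "g = g'"
proof -
  have d: "g - g' \<in> Rn n" using assms by (intro Rn_intros)
  have "g \<bullet> (g - g') = g' \<bullet> (g - g')"
    using has_derivative_line[of x 0 "g - g'" n f] assms d by (intro DERIV_unique) auto
  then have "(g - g') \<bullet> (g - g') = 0" by (simp add: inner_diff_left)
  then show ?thesis by simp
qed

lemma grad_eqI:
  assumes "x \<in> Rn n" "g \<in> Rn n" "(f has_derivative (\<lambda>v. g \<bullet> v)) (at x within Rn n)"
  shows "grad n f x = g"
  unfolding grad_def using assms has_derivative_Rn_unique by (intro the_equality) blast+

lemma grad:
  assumes "f differentiable_on Rn n" "x \<in> Rn n"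
  shows grad_in_Rn: "grad n f x \<in> Rn n"
    and has_derivative_grad: "(f has_derivative (\<lambda>v. grad n f x \<bullet> v)) (at x within Rn n)"
proof -
  obtain D where D: "(f has_derivative D) (at x within Rn n)"
    using assms by (auto simp: differentiable_on_def differentiable_def)
  then interpret D: bounded_linear D by (rule has_derivative_bounded_linear)
  define g where "g = mk_vec n (\<lambda>i. D (Poly_Mapping.single i 1))"
  have g: "g \<in> Rn n" by (simp add: g_def mk_vec_in_Rn)
  \<comment> \<open>\<open>D\<close> and the inner product with \<open>g\<close> agree on
    \<open>Rn n\<close> only. This suffices, because the limit within \<open>Rn n\<close> tests only
    differences \<open>y - x\<close> in \<open>Rn n\<close>.\<close>
  have eq: "g \<bullet> v = D v" if "v \<in> Rn n" for v
  proof -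
    have "D v = (\<Sum>i<n. v \<cdot> i * D (Poly_Mapping.single i 1))"
      by (subst Rn_expansion[OF that]) (simp add: D.sum D.scaleR)
    also have "\<dots> = g \<bullet> v"
      by (simp add: inner_Rn[OF g]) (simp add: g_def lookup_mk_vec mult.commute)
    finally show ?thesis by simp
  qed
  have "(f has_derivative (\<lambda>v. g \<bullet> v)) (at x within Rn n)"
    unfolding has_derivative_within
  proof (intro conjI bounded_linear_inner_right)
    have "((\<lambda>y. (1 / norm (y - x)) *\<^sub>R (f y - (f x + D (y - x)))) \<longlongrightarrow> 0) (at x within Rn n)"
      using D by (simp add: has_derivative_within)
    then show "((\<lambda>y. (1 / norm (y - x)) *\<^sub>R (f y - (f x + g \<bullet> (y - x)))) \<longlongrightarrow> 0) (at x within Rn n)"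
      by (rule Lim_transform_within[OF _ zero_less_one]) (simp add: eq Rn_intros assms(2))
  qed
  moreover from this have "grad n f x = g" by (rule grad_eqI[OF assms(2) g])
  ultimately show "grad n f x \<in> Rn n" "(f has_derivative (\<lambda>v. grad n f x \<bullet> v)) (at x within Rn n)"
    using g by simp_all
qed

lemma convex_gradient_ineq:
  assumes cvx: "convex_on (Rn n) f" and f: "f differentiable_on Rn n"
    and x: "x \<in> Rn n" and y: "y \<in> Rn n"
  shows "f x + grad n f x \<bullet> (y - x) \<le> f y"
proof -
  have d: "y - x \<in> Rn n" using x y by (intro Rn_intros)
  have "((\<lambda>t. f (x + t *\<^sub>R (y - x))) has_real_derivative grad n f x \<bullet> (y - x)) (at 0)"
    using has_derivative_line[of x 0 "y - x" n f] has_derivative_grad[OF f x] x d by simp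
  then have "((\<lambda>t. f (x + t *\<^sub>R (y - x))) has_real_derivative grad n f x \<bullet> (y - x)) (at_right 0)"
    by (rule DERIV_subset) simp
  then have lim: "((\<lambda>t. (f (x + t *\<^sub>R (y - x)) - f x) / t) \<longlongrightarrow> grad n f x \<bullet> (y - x)) (at_right 0)"
    by (simp add: has_field_derivative_iff)
  have "grad n f x \<bullet> (y - x) \<le> f y - f x"
  proof (rule tendsto_upperbound[OF lim])
    have ev: "\<forall>\<^sub>F t in at_right (0::real). t \<in> {0<..<1}"
      by (rule eventually_at_right_real) simp
    have *: "(f (x + t *\<^sub>R (y - x)) - f x) / t \<le> f y - f x" if "t \<in> {0<..<1}" for t
    proof -
      have "f (x + t *\<^sub>R (y - x)) \<le> (1 - t) * f x + t * f y"
        using convex_onD[OF cvx, of t x y] that x y by (simp add: algebra_simps)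
      then show ?thesis using that by (simp add: field_simps)
    qed
    show "\<forall>\<^sub>F t in at_right 0. (f (x + t *\<^sub>R (y - x)) - f x) / t \<le> f y - f x"
      using ev by (rule eventually_mono) (rule *)
  qed simp
  then show ?thesis by simp
qed

lemma smooth_upper_bound:
  assumes f: "f differentiable_on Rn n" and lip: "L-lipschitz_on (Rn n) (grad n f)"
    and x: "x \<in> Rn n" and y: "y \<in> Rn n"
  shows "f y \<le> f x + grad n f x \<bullet> (y - x) + L / 2 * (norm (y - x))\<^sup>2"
proof -
  define d where "d = y - x"
  have d: "d \<in> Rn n" unfolding d_def using x y by (intro Rn_intros)
  \<comment> \<open>The excess of \<open>f\<close> over its quadratic model along the segment, up to
    the constant \<open>f x\<close>. The Lipschitz gradient makes its derivative nonpositive for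
    \<open>t \<ge> 0\<close>.\<close>
  define \<phi> where "\<phi> t = f (x + t *\<^sub>R d) - t * (grad n f x \<bullet> d) - L * t\<^sup>2 / 2 * (norm d)\<^sup>2" for t
  have xt: "x + t *\<^sub>R d \<in> Rn n" for t using x d by (intro Rn_intros)
  have D: "(\<phi> has_real_derivative
      (grad n f (x + t *\<^sub>R d) \<bullet> d - grad n f x \<bullet> d - L * t * (norm d)\<^sup>2)) (at t)" for t
    unfolding \<phi>_def
    by (auto intro!: derivative_eq_intros has_derivative_line[OF xt d has_derivative_grad[OF f xt]])
  have nonpos: "grad n f (x + t *\<^sub>R d) \<bullet> d - grad n f x \<bullet> d - L * t * (norm d)\<^sup>2 \<le> 0" if "0 \<le> t" for t
  proof -
    have "(grad n f (x + t *\<^sub>R d) - grad n f x) \<bullet> d \<le> norm (grad n f (x + t *\<^sub>R d) - grad n f x) * norm d"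
      by (rule norm_cauchy_schwarz)
    also have "norm (grad n f (x + t *\<^sub>R d) - grad n f x) \<le> L * norm (t *\<^sub>R d)"
      using lipschitz_onD[OF lip xt x, of t] by (simp add: dist_norm)
    finally show ?thesis using that
      by (simp add: inner_diff_left power2_eq_square mult_right_mono algebra_simps)
  qed
  have "\<phi> 1 \<le> \<phi> 0"
    using D nonpos by (intro DERIV_nonpos_imp_nonincreasing[of 0 1 \<phi>]) (auto intro!: exI)
  then show ?thesis by (simp add: \<phi>_def d_def)
qed

section \<open>Accelerated gradient descent\<close>

lemma agd_snd_Suc:
  "snd (agd dF \<alpha> \<beta> x0 (Suc t)) =
     fst (agd dF \<alpha> \<beta> x0 (Suc t)) +
     ((sqrt (\<beta> / \<alpha>) - 1) / (sqrt (\<beta> / \<alpha>) + 1)) *\<^sub>R (fst (agd dF \<alpha> \<beta> x0 (Suc t)) - fst (agd dF \<alpha> \<beta> x0 t))"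
proof -
  have "(1 + q) *\<^sub>R y' - q *\<^sub>R y = y' + q *\<^sub>R (y' - y)" for q :: real and y y' :: vec
    by (simp add: algebra_simps)
  then show ?thesis by (simp only: agd.simps Let_def case_prod_beta fst_conv snd_conv)
qed

lemma agd_fst_Suc:
  "fst (agd dF \<alpha> \<beta> x0 (Suc t)) = snd (agd dF \<alpha> \<beta> x0 t) - (1 / \<beta>) *\<^sub>R dF (snd (agd dF \<alpha> \<beta> x0 t))"
  by (simp add: Let_def case_prod_beta)

lemma agd_in_subspace:
  assumes "subspace V" "x0 \<in> V" "\<And>x. x \<in> V \<Longrightarrow> dF x \<in> V"
  shows "fst (agd dF \<alpha> \<beta> x0 t) \<in> V \<and> snd (agd dF \<alpha> \<beta> x0 t) \<in> V"
proof (induction t)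
  case (Suc t)
  then have "fst (agd dF \<alpha> \<beta> x0 (Suc t)) \<in> V"
    unfolding agd_fst_Suc using assms by (intro subspace_diff subspace_scale) auto
  then show ?case
    unfolding agd_snd_Suc using Suc assms by (auto intro!: subspace_add subspace_diff subspace_scale)
qed (use assms in simp)

lemma norm_convex_combination_le:
  fixes a b :: "'a :: real_inner"
  assumes "0 \<le> p" "p \<le> 1"
  shows "(norm ((1 - p) *\<^sub>R a + p *\<^sub>R b))\<^sup>2 \<le> (1 - p) * (norm a)\<^sup>2 + p * (norm b)\<^sup>2"
proof -
  have "(1 - p) * (norm a)\<^sup>2 + p * (norm b)\<^sup>2 - (norm ((1 - p) *\<^sub>R a + p *\<^sub>R b))\<^sup>2
      = (1 - p) * p * (norm (a - b))\<^sup>2"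
    unfolding power2_norm_eq_inner
    by (simp add: inner_add_left inner_add_right inner_diff_left inner_diff_right inner_commute)
       algebra
  moreover have "0 \<le> (1 - p) * p * (norm (a - b))\<^sup>2" using assms by simp
  ultimately show ?thesis by linarith
qed

text \<open>
  One step of the estimate sequence argument.  With \<open>q = sqrt (\<beta> / \<alpha>)\<close> and \<open>p = 1 / q\<close>, the sequence
  \<open>v = (q + 1) x - q y\<close> makes \<open>F y - F u + \<alpha> / 2 * (norm (v - u))\<^sup>2\<close> decrease by the factor \<open>1 - p\<close>,
  for every comparison point \<open>u\<close>, optimal or not.
\<close>

lemma agd_potential_step:
  fixes F :: "vec \<Rightarrow> real" and x y u g y' v v' :: vec
  assumes \<alpha>: "0 < \<alpha>" and q: "1 \<le> q" and \<beta>: "\<beta> = \<alpha> * q\<^sup>2"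
    and lower: "\<And>z. z \<in> V \<Longrightarrow> F x + g \<bullet> (z - x) + \<alpha> / 2 * (norm (z - x))\<^sup>2 \<le> F z"
    and upper: "\<And>z. z \<in> V \<Longrightarrow> F z \<le> F x + g \<bullet> (z - x) + \<beta> / 2 * (norm (z - x))\<^sup>2"
    and V: "y \<in> V" "u \<in> V" "y' \<in> V"
    and y': "y' = x - (1 / \<beta>) *\<^sub>R g"
    and v: "v = (q + 1) *\<^sub>R x - q *\<^sub>R y" and v': "v' = q *\<^sub>R y' - (q - 1) *\<^sub>R y"
  shows "F y' - F u + \<alpha> / 2 * (norm (v' - u))\<^sup>2
    \<le> (1 - 1 / q) * (F y - F u + \<alpha> / 2 * (norm (v - u))\<^sup>2)"
proof -
  define p where "p = 1 / q"
  have p: "0 < p" "p \<le> 1" "q = 1 / p" using q by (auto simp: p_def)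
  have \<beta>0: "0 < \<beta>" and \<beta>p: "1 / \<beta> = p\<^sup>2 / \<alpha>" using \<alpha> q by (auto simp: \<beta> p_def power2_eq_square)
  \<comment> \<open>The gradient-free part of \<open>v' - u\<close>: a convex combination, so its
    squared norm splits into the old potential term and a term that the strong convexity bound at
    \<open>u\<close> absorbs.\<close>
  define w where "w = (1 - p) *\<^sub>R (v - u) + p *\<^sub>R (x - u)"
  have F1: "F y' \<le> F x - 1 / (2 * \<beta>) * (norm g)\<^sup>2"
  proof -
    have "g \<bullet> (y' - x) + \<beta> / 2 * (norm (y' - x))\<^sup>2 = - (1 / (2 * \<beta>)) * (norm g)\<^sup>2"
    proof -
      have "g \<bullet> (y' - x) = - (1 / \<beta>) * (norm g)\<^sup>2" "(norm (y' - x))\<^sup>2 = (1 / \<beta>)\<^sup>2 * (norm g)\<^sup>2"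
        using \<beta>0 by (simp_all add: y' power_divide power2_norm_eq_inner)
      then show ?thesis using \<beta>0 by (simp add: field_simps power2_eq_square)
    qed
    then show ?thesis using upper[OF V(3)] by simp
  qed
  have v'w: "v' - u = w - (p / \<alpha>) *\<^sub>R g"
  proof -
    have "q * (1 / \<beta>) = p / \<alpha>" using p \<alpha> by (simp only: \<beta>p) (simp add: p(3) power2_eq_square)
    then have v'_eq: "v' = q *\<^sub>R x - (p / \<alpha>) *\<^sub>R g - (q - 1) *\<^sub>R y"
      by (simp add: v' y' scaleR_diff_right)
    have "(1 - p) *\<^sub>R v + p *\<^sub>R x = q *\<^sub>R x - (q - 1) *\<^sub>R y"
    proof -
      have "(1 - p) * (q + 1) + p = q" "(1 - p) * q = q - 1" using p by (simp_all add: field_simps)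
      moreover have "(1 - p) *\<^sub>R v + p *\<^sub>R x = ((1 - p) * (q + 1) + p) *\<^sub>R x - ((1 - p) * q) *\<^sub>R y"
        by (simp only: v scaleR_diff_right scaleR_scaleR scaleR_add_left[of "(1 - p) * (q + 1)" p] diff_add_eq)
      ultimately show ?thesis by simp
    qed
    moreover have "w = (1 - p) *\<^sub>R v + p *\<^sub>R x - u" by (simp add: w_def algebra_simps)
    ultimately have w_eq: "w = q *\<^sub>R x - (q - 1) *\<^sub>R y - u" by simp
    show ?thesis unfolding v'_eq w_eq by (simp add: algebra_simps)
  qed
  have "\<alpha> / 2 * (norm (v' - u))\<^sup>2 = \<alpha> / 2 * (norm w)\<^sup>2 - p * (g \<bullet> w) + 1 / (2 * \<beta>) * (norm g)\<^sup>2"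
  proof -
    have expand: "(norm (v' - u))\<^sup>2 = (norm w)\<^sup>2 - 2 * (p / \<alpha>) * (g \<bullet> w) + (p / \<alpha>)\<^sup>2 * (norm g)\<^sup>2"
      unfolding v'w power2_norm_eq_inner
      by (simp add: inner_diff_left inner_diff_right inner_commute power2_eq_square algebra_simps)
    have "\<alpha> / 2 * (norm (v' - u))\<^sup>2
        = \<alpha> / 2 * (norm w)\<^sup>2 - p * (g \<bullet> w) + \<alpha> / 2 * (p / \<alpha>)\<^sup>2 * (norm g)\<^sup>2"
      unfolding expand using \<alpha> by (simp add: algebra_simps)
    moreover have "\<alpha> / 2 * (p / \<alpha>)\<^sup>2 = 1 / (2 * \<beta>)"
      using \<beta>p \<alpha> by (simp add: power2_eq_square)
    ultimately show ?thesis by simp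
  qed
  moreover have "\<alpha> / 2 * (norm w)\<^sup>2 \<le> \<alpha> / 2 * ((1 - p) * (norm (v - u))\<^sup>2 + p * (norm (x - u))\<^sup>2)"
    unfolding w_def using p \<alpha> by (intro mult_left_mono norm_convex_combination_le) auto
  moreover have "p * (F x - F u + \<alpha> / 2 * (norm (x - u))\<^sup>2) \<le> p * (g \<bullet> (x - u))"
    using lower[OF V(2)] p by (intro mult_left_mono) (auto simp: inner_diff_right norm_minus_commute)
  moreover have "(1 - p) * (F x - F y) \<le> (1 - p) * (g \<bullet> (x - y))"
  proof (intro mult_left_mono)
    have "0 \<le> \<alpha> / 2 * (norm (y - x))\<^sup>2" using \<alpha> by simp
    then show "F x - F y \<le> g \<bullet> (x - y)" using lower[OF V(1)] by (simp add: inner_diff_right)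
  qed (use p in simp)
  \<comment> \<open>The terms linear in \<open>g\<close> cancel: those of the lower bounds at
    \<open>u\<close> and \<open>y\<close>, with weights \<open>p\<close> and \<open>1 - p\<close>,
    against the cross term of \<open>v' - u\<close>. The squared norm of \<open>g\<close> cancels
    against the descent in \<open>F1\<close>.\<close>
  moreover have "p * (g \<bullet> (x - u)) + (1 - p) * (g \<bullet> (x - y)) - p * (g \<bullet> w) = 0"
  proof -
    have "p *\<^sub>R v = (1 + p) *\<^sub>R x - y" using p by (simp add: v scaleR_diff_right) (simp add: algebra_simps)
    then have "p * (g \<bullet> v) = (1 + p) * (g \<bullet> x) - g \<bullet> y"
      by (metis inner_diff_right inner_scaleR_right)
    moreover have "p * (g \<bullet> w) = (1 - p) * (p * (g \<bullet> v)) - p * (1 - p) * (g \<bullet> u) + p\<^sup>2 * (g \<bullet> x - g \<bullet> u)"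
      by (simp add: w_def inner_diff_right inner_add_right algebra_simps power2_eq_square)
    ultimately show ?thesis
      unfolding inner_diff_right by algebra
  qed
  ultimately show ?thesis using F1 unfolding p_def[symmetric]
    by (simp add: algebra_simps add_divide_distrib diff_divide_distrib)
qed

lemma agd_convergence:
  fixes F :: "vec \<Rightarrow> real"
  assumes V: "subspace V" "x0 \<in> V" "u \<in> V" "\<And>x. x \<in> V \<Longrightarrow> dF x \<in> V"
    and \<alpha>: "0 < \<alpha>" "\<alpha> \<le> \<beta>"
    and lower: "\<And>x z. x \<in> V \<Longrightarrow> z \<in> V \<Longrightarrow> F x + dF x \<bullet> (z - x) + \<alpha> / 2 * (norm (z - x))\<^sup>2 \<le> F z"
    and upper: "\<And>x z. x \<in> V \<Longrightarrow> z \<in> V \<Longrightarrow> F z \<le> F x + dF x \<bullet> (z - x) + \<beta> / 2 * (norm (z - x))\<^sup>2"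
  shows "F (fst (agd dF \<alpha> \<beta> x0 t)) - F u
    \<le> (1 - 1 / sqrt (\<beta> / \<alpha>)) ^ t * (F x0 - F u + \<alpha> / 2 * (norm (x0 - u))\<^sup>2)"
proof -
  define q where "q = sqrt (\<beta> / \<alpha>)"
  have q: "1 \<le> q" using \<alpha> by (simp add: q_def)
  have \<beta>: "\<beta> = \<alpha> * q\<^sup>2" using \<alpha> by (simp add: q_def)
  define y x where "y t = fst (agd dF \<alpha> \<beta> x0 t)" and "x t = snd (agd dF \<alpha> \<beta> x0 t)" for t
  have yx: "y t \<in> V" "x t \<in> V" for t using agd_in_subspace[of V x0 dF] V by (auto simp: y_def x_def)
  have ySuc: "y (Suc t) = x t - (1 / \<beta>) *\<^sub>R dF (x t)" for t by (simp only: y_def x_def agd_fst_Suc)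
  define v where "v t = (q + 1) *\<^sub>R x t - q *\<^sub>R y t" for t
  \<comment> \<open>The momentum coefficient is \<open>(q - 1) / (q + 1)\<close>, so multiplying by
    \<open>q + 1\<close> leaves an expression in the \<open>y\<close> iterates alone, as the
    potential step requires.\<close>
  have vSuc: "v (Suc t) = q *\<^sub>R y (Suc t) - (q - 1) *\<^sub>R y t" for t
  proof -
    have "x (Suc t) = y (Suc t) + ((q - 1) / (q + 1)) *\<^sub>R (y (Suc t) - y t)"
      by (simp only: x_def y_def agd_snd_Suc q_def)
    then have "(q + 1) *\<^sub>R x (Suc t) = (q + 1) *\<^sub>R y (Suc t) + (q - 1) *\<^sub>R (y (Suc t) - y t)"
      using q by (simp add: scaleR_add_right)
    then show ?thesis unfolding v_def by (simp add: algebra_simps)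
  qed
  define \<Phi> where "\<Phi> t = F (y t) - F u + \<alpha> / 2 * (norm (v t - u))\<^sup>2" for t
  have "\<Phi> t \<le> (1 - 1 / q) ^ t * \<Phi> 0" for t
  proof (induction t)
    case (Suc t)
    have "\<Phi> (Suc t) \<le> (1 - 1 / q) * \<Phi> t"
      unfolding \<Phi>_def
      by (rule agd_potential_step[OF \<alpha>(1) q \<beta> lower[OF yx(2)] upper[OF yx(2)] yx(1) V(3) yx(1)
            ySuc v_def vSuc])
    also have "\<dots> \<le> (1 - 1 / q) * ((1 - 1 / q) ^ t * \<Phi> 0)"
      using Suc q by (intro mult_left_mono) auto
    finally show ?case by simp
  qed simp
  moreover have "F (y t) - F u \<le> \<Phi> t" using \<alpha> by (simp add: \<Phi>_def)
  moreover have "\<Phi> 0 = F x0 - F u + \<alpha> / 2 * (norm (x0 - u))\<^sup>2"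
    by (simp add: \<Phi>_def v_def y_def x_def algebra_simps)
  ultimately show ?thesis unfolding y_def q_def by (metis order_trans)
qed

text \<open>
  Comparing with \<open>x0\<close> itself reduces to points \<open>u\<close> with \<open>F u \<le> F x0\<close>, which are at distance at most
  \<open>norm (dF x0)\<close> from \<open>x0\<close> by strong convexity.
\<close>

lemma agd_convergence_grad:
  fixes F :: "vec \<Rightarrow> real"
  assumes V: "subspace V" "x0 \<in> V" "u \<in> V" "\<And>x. x \<in> V \<Longrightarrow> dF x \<in> V"
    and \<beta>: "2 \<le> \<beta>"
    and lower: "\<And>x z. x \<in> V \<Longrightarrow> z \<in> V \<Longrightarrow> F x + dF x \<bullet> (z - x) + (norm (z - x))\<^sup>2 \<le> F z"
    and upper: "\<And>x z. x \<in> V \<Longrightarrow> z \<in> V \<Longrightarrow> F z \<le> F x + dF x \<bullet> (z - x) + \<beta> / 2 * (norm (z - x))\<^sup>2"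
  shows "F (fst (agd dF 2 \<beta> x0 t)) - F u \<le> (1 - 1 / sqrt (\<beta> / 2)) ^ t * (norm (dF x0))\<^sup>2"
proof -
  have nn: "0 \<le> (1 - 1 / sqrt (\<beta> / 2)) ^ t" using \<beta> by simp
  have conv: "F (fst (agd dF 2 \<beta> x0 t)) - F z
    \<le> (1 - 1 / sqrt (\<beta> / 2)) ^ t * (F x0 - F z + (norm (x0 - z))\<^sup>2)" if "z \<in> V" for z
    using agd_convergence[of V x0 z dF 2 \<beta> F t] assms that by simp
  show ?thesis
  proof (cases "F u \<le> F x0")
    case True
    have *: "F x0 - F u + (norm (x0 - u))\<^sup>2 \<le> norm (dF x0) * norm (x0 - u)"
      using lower[OF V(2,3)] norm_cauchy_schwarz[of "dF x0" "x0 - u"]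
      by (simp add: inner_diff_right norm_minus_commute)
    then have "norm (x0 - u) * norm (x0 - u) \<le> norm (dF x0) * norm (x0 - u)"
      using True by (simp add: power2_eq_square)
    then have "norm (x0 - u) \<le> norm (dF x0)"
      by (cases "norm (x0 - u) = 0") (auto simp: mult_le_cancel_right)
    then have "F x0 - F u + (norm (x0 - u))\<^sup>2 \<le> (norm (dF x0))\<^sup>2"
      by (intro order_trans[OF *]) (simp add: power2_eq_square mult_left_mono)
    with nn conv[OF V(3)] show ?thesis by (meson mult_left_mono order_trans)
  next
    case False
    \<comment> \<open>With \<open>x0\<close> as comparison point the initial potential is zero, so
      the iterate's value is at most \<open>F x0\<close>, which is below \<open>F u\<close>.\<close>
    then have "F (fst (agd dF 2 \<beta> x0 t)) - F u \<le> 0" using conv[OF V(2)] by simp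
    also have "0 \<le> (1 - 1 / sqrt (\<beta> / 2)) ^ t * (norm (dF x0))\<^sup>2" using nn by simp
    finally show ?thesis .
  qed
qed

section \<open>The Lagrangian\<close>

locale projection_setting =
  fixes n m :: nat and x0 :: vec and h :: "nat \<Rightarrow> vec \<Rightarrow> real" and L G H R B :: real
  assumes problem: "projection_problem n m x0 h L G H R B"
begin

abbreviation "\<K> \<equiv> feasible n m h"

lemma m_pos: "1 \<le> m" and n_pos: "1 \<le> n" and x0_in: "x0 \<in> Rn n"
  and h_convex: "i < m \<Longrightarrow> convex_on (Rn n) (h i)"
  and h_diff: "i < m \<Longrightarrow> h i differentiable_on Rn n"
  and grad_lipschitz: "i < m \<Longrightarrow> L-lipschitz_on (Rn n) (grad n (h i))"
  and h_lipschitz: "i < m \<Longrightarrow> G-lipschitz_on (convex hull (insert x0 \<K>)) (h i)"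
  and h_bound: "i < m \<Longrightarrow> x \<in> \<K> \<Longrightarrow> \<bar>h i x\<bar> \<le> H"
  using problem by (auto simp: projection_problem_def)

lemma L_nonneg: "0 \<le> L" and G_nonneg: "0 \<le> G"
  using m_pos grad_lipschitz[of 0] h_lipschitz[of 0] by (auto simp: lipschitz_on_def)

lemma h_gradient_ineq:
  "i < m \<Longrightarrow> x \<in> Rn n \<Longrightarrow> y \<in> Rn n \<Longrightarrow> h i x + grad n (h i) x \<bullet> (y - x) \<le> h i y"
  by (intro convex_gradient_ineq h_convex h_diff)

lemma h_smooth:
  "i < m \<Longrightarrow> x \<in> Rn n \<Longrightarrow> y \<in> Rn n \<Longrightarrow>
    h i y \<le> h i x + grad n (h i) x \<bullet> (y - x) + L / 2 * (norm (y - x))\<^sup>2"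
  by (intro smooth_upper_bound h_diff grad_lipschitz)

section \<open>Slater's condition and the gradient bound on the hull\<close>

lemma feasible_subset: "\<K> \<subseteq> Rn n"
  by (auto simp: feasible_def)

lemma hull_subset: "convex hull (insert x0 \<K>) \<subseteq> Rn n"
  by (rule hull_minimal) (use feasible_subset x0_in convex_Rn in auto)

lemma slater_ball:
  obtains z r where "z \<in> Rn n" "0 < r" "\<And>y. y \<in> Rn n \<Longrightarrow> dist y z < r \<Longrightarrow> y \<in> \<K>"
proof -
  obtain z where z: "z \<in> Rn n" "\<And>i. i < m \<Longrightarrow> h i z < 0"
    using problem by (auto simp: projection_problem_def)
  have "\<forall>\<^sub>F y in at z within Rn n. \<forall>i\<in>{..<m}. h i y < 0"
  proof (rule eventually_ball_finite)
    show "\<forall>i\<in>{..<m}. \<forall>\<^sub>F y in at z within Rn n. h i y < 0"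
    proof
      fix i assume "i \<in> {..<m}"
      then have "(h i \<longlongrightarrow> h i z) (at z within Rn n)"
        using differentiable_imp_continuous_on[OF h_diff] z(1) by (auto simp: continuous_on_def)
      then show "\<forall>\<^sub>F y in at z within Rn n. h i y < 0"
        using z(2) \<open>i \<in> {..<m}\<close> by (intro order_tendstoD(2)) auto
    qed
  qed simp
  then obtain r where r: "0 < r" "\<And>y. y \<in> Rn n \<Longrightarrow> y \<noteq> z \<Longrightarrow> dist y z < r \<Longrightarrow> \<forall>i\<in>{..<m}. h i y < 0"
    by (auto simp: eventually_at)
  have "y \<in> \<K>" if "y \<in> Rn n" "dist y z < r" for y
    using r(2)[OF that(1) _ that(2)] z that(1) by (cases "y = z") (auto simp: feasible_def less_imp_le)
  then show thesis using that[OF z(1) r(1)] by blast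
qed

text \<open>
  The hull has interior points by Slater's condition; the Lipschitz bound controls the gradient
  there, and points arbitrarily close to any given point of the hull are of this kind.
\<close>

lemma grad_bound:
  assumes i: "i < m" and x: "x \<in> convex hull (insert x0 \<K>)"
  shows "norm (grad n (h i) x) \<le> G"
proof -
  obtain z r where z: "z \<in> Rn n" and r: "0 < r" and ball: "\<And>y. y \<in> Rn n \<Longrightarrow> dist y z < r \<Longrightarrow> y \<in> \<K>"
    using slater_ball by blast
  have xV: "x \<in> Rn n" using x hull_subset by blast
  have near: "norm (grad n (h i) ((1 - s) *\<^sub>R x + s *\<^sub>R z)) \<le> G" if s: "0 < s" "s \<le> 1" for s
  proof -
    define y where "y = (1 - s) *\<^sub>R x + s *\<^sub>R z"
    have yV: "y \<in> Rn n" unfolding y_def by (intro Rn_intros xV z)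
    define g where "g = grad n (h i) y"
    have gV: "g \<in> Rn n" unfolding g_def by (rule grad_in_Rn[OF h_diff[OF i] yV])
    \<comment> \<open>Moving \<open>y\<close> by \<open>c *\<^sub>R g\<close> amounts to moving the
      Slater point \<open>z\<close>, which has weight \<open>s\<close>, by
      \<open>(c / s) *\<^sub>R g\<close>. For \<open>c \<le> t\<close> this shift is at most
      \<open>r / 2\<close>, inside the feasible ball.\<close>
    define t where "t = s * r / (2 * (norm g + 1))"
    have t: "0 < t" using s r by (auto simp: t_def intro!: divide_pos_pos add_nonneg_pos)
    have hull: "y + c *\<^sub>R g \<in> convex hull (insert x0 \<K>)" if c: "0 \<le> c" "c \<le> t" for c
    proof -
      have "c / s * norm g \<le> t / s * (norm g + 1)" using c s by (intro mult_mono divide_right_mono) auto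
      also have "\<dots> = r / 2"
      proof -
        have "s * r / (2 * N) / s * N = r / 2" if "N \<noteq> 0" for N :: real
          using s that by simp
        moreover have "norm g + 1 \<noteq> 0" using norm_ge_zero[of g] by linarith
        ultimately show ?thesis unfolding t_def by blast
      qed
      finally have "c / s * norm g < r" using r by linarith
      then have "dist (z + (c / s) *\<^sub>R g) z < r" using c s by (simp add: dist_norm)
      then have "z + (c / s) *\<^sub>R g \<in> convex hull (insert x0 \<K>)"
        by (intro hull_inc insertI2 ball Rn_intros z gV)
      then have "(1 - s) *\<^sub>R x + s *\<^sub>R (z + (c / s) *\<^sub>R g) \<in> convex hull (insert x0 \<K>)"
        using s x by (intro convexD[OF convex_convex_hull]) auto
      then show ?thesis using s by (simp add: y_def algebra_simps)
    qed
    \<comment> \<open>Along \<open>g\<close> itself, convexity forces a rise of at least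
      \<open>t * (norm g)\<^sup>2\<close>, while the Lipschitz bound allows only
      \<open>t * G * norm g\<close>.\<close>
    have "t * (norm g)\<^sup>2 = g \<bullet> ((y + t *\<^sub>R g) - y)" by (simp add: power2_norm_eq_inner)
    also have "\<dots> \<le> h i (y + t *\<^sub>R g) - h i y"
      using h_gradient_ineq[OF i yV, of "y + t *\<^sub>R g"] yV gV by (simp add: g_def Rn_intros)
    also have "\<dots> \<le> G * dist (y + t *\<^sub>R g) y"
      using lipschitz_onD[OF h_lipschitz[OF i] hull[of t] hull[of 0]] t by (simp add: dist_real_def)
    also have "\<dots> = t * (G * norm g)" using t by (simp add: dist_norm)
    finally have "(norm g)\<^sup>2 \<le> G * norm g" using t by simp
    then have "norm g \<le> G"
      using G_nonneg by (cases "norm g = 0") (auto simp: power2_eq_square)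
    then show ?thesis by (simp add: g_def y_def)
  qed
  show ?thesis
  proof (rule field_le_epsilon)
    fix e :: real assume e: "0 < e"
    define s where "s = min 1 (e / (L * norm (z - x) + 1))"
    have d: "0 < L * norm (z - x) + 1" using L_nonneg by (intro add_nonneg_pos) auto
    have s: "0 < s" "s \<le> 1" using e d by (auto simp: s_def)
    have "s * (L * norm (z - x)) \<le> s * (L * norm (z - x) + 1)"
      using s by (intro mult_left_mono) auto
    also have "\<dots> \<le> e"
      using pos_le_divide_eq[OF d, of s e] by (simp add: s_def)
    finally have se: "s * (L * norm (z - x)) \<le> e" .
    define y where "y = (1 - s) *\<^sub>R x + s *\<^sub>R z"
    have yV: "y \<in> Rn n" unfolding y_def by (intro Rn_intros xV z)
    have "dist x y = s * norm (z - x)"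
    proof -
      have "x - y = (- s) *\<^sub>R (z - x)" by (simp add: y_def algebra_simps)
      then show ?thesis using s by (simp add: dist_norm del: scaleR_minus_left)
    qed
    then have "norm (grad n (h i) x - grad n (h i) y) \<le> e"
      using lipschitz_onD[OF grad_lipschitz[OF i] xV yV] se by (simp add: dist_norm algebra_simps)
    moreover have "norm (grad n (h i) y) \<le> G" unfolding y_def by (rule near[OF s])
    ultimately show "norm (grad n (h i) x) \<le> G + e"
      using norm_triangle_sub[of "grad n (h i) x" "grad n (h i) y"] by linarith
  qed
qed

section \<open>The Lagrangian as a strongly convex smooth function\<close>

definition lagr_grad :: "vec \<Rightarrow> vec \<Rightarrow> vec" where
  "lagr_grad l x = 2 *\<^sub>R (x - x0) + (\<Sum>i<m. l \<cdot> i *\<^sub>R grad n (h i) x)"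

lemma lagr_grad_in: "x \<in> Rn n \<Longrightarrow> lagr_grad l x \<in> Rn n"
  unfolding lagr_grad_def by (intro Rn_intros x0_in grad_in_Rn h_diff) auto

lemma grad_lagr:
  assumes x: "x \<in> Rn n"
  shows "grad n (\<lambda>x. lagr m x0 h x l) x = lagr_grad l x"
proof (rule grad_eqI[OF x lagr_grad_in[OF x]])
  have "((\<lambda>x. (x - x0) \<bullet> (x - x0) + (\<Sum>i<m. l \<cdot> i * h i x)) has_derivative
      (\<lambda>v. ((x - x0) \<bullet> v + v \<bullet> (x - x0)) + (\<Sum>i<m. l \<cdot> i * (grad n (h i) x \<bullet> v)))) (at x within Rn n)"
    by (intro has_derivative_add has_derivative_sum has_derivative_mult_right
        has_derivative_grad[OF h_diff x]) (auto intro!: derivative_eq_intros)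
  then show "((\<lambda>x. lagr m x0 h x l) has_derivative (\<lambda>v. lagr_grad l x \<bullet> v)) (at x within Rn n)"
    unfolding lagr_def power2_norm_eq_inner lagr_grad_def
    by (rule has_derivative_eq_rhs)
      (simp add: fun_eq_iff inner_add_left inner_sum_left inner_sum_right inner_diff_left inner_diff_right
        inner_commute algebra_simps)
qed

text \<open>The squared distance equals its second-order expansion, which supplies the quadratic
  term; nonnegative multipliers preserve the tangent inequalities of the constraints.\<close>

lemma lagr_strongly_convex:
  assumes l: "l \<in> nonneg m" and x: "x \<in> Rn n" and z: "z \<in> Rn n"
  shows "lagr m x0 h x l + lagr_grad l x \<bullet> (z - x) + (norm (z - x))\<^sup>2 \<le> lagr m x0 h z l"
proof -
  have "(\<Sum>i<m. l \<cdot> i * (h i x + grad n (h i) x \<bullet> (z - x))) \<le> (\<Sum>i<m. l \<cdot> i * h i z)"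
    using l by (intro sum_mono mult_left_mono h_gradient_ineq x z) (auto simp: nonneg_def)
  then have "(\<Sum>i<m. l \<cdot> i * h i x) + (\<Sum>i<m. l \<cdot> i * (grad n (h i) x \<bullet> (z - x))) \<le> (\<Sum>i<m. l \<cdot> i * h i z)"
    by (simp add: distrib_left sum.distrib)
  moreover have "(norm (x - x0))\<^sup>2 + 2 * ((x - x0) \<bullet> (z - x)) + (norm (z - x))\<^sup>2 = (norm (z - x0))\<^sup>2"
    unfolding power2_norm_eq_inner by (simp add: inner_diff_left inner_diff_right inner_commute)
  ultimately show ?thesis
    unfolding lagr_def lagr_grad_def by (simp add: inner_add_left inner_sum_left)
qed

lemma lagr_smooth:
  assumes l: "l \<in> nonneg m" and x: "x \<in> Rn n" and z: "z \<in> Rn n"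
  shows "lagr m x0 h z l
    \<le> lagr m x0 h x l + lagr_grad l x \<bullet> (z - x) + smoothness m L l / 2 * (norm (z - x))\<^sup>2"
proof -
  have "(\<Sum>i<m. l \<cdot> i * h i z)
      \<le> (\<Sum>i<m. l \<cdot> i * (h i x + grad n (h i) x \<bullet> (z - x) + L / 2 * (norm (z - x))\<^sup>2))"
    using l by (intro sum_mono mult_left_mono h_smooth x z) (auto simp: nonneg_def)
  also have "\<dots> = (\<Sum>i<m. l \<cdot> i * h i x) + (\<Sum>i<m. l \<cdot> i * (grad n (h i) x \<bullet> (z - x)))
      + (\<Sum>i<m. l \<cdot> i) * (L / 2 * (norm (z - x))\<^sup>2)"
    by (simp add: distrib_left sum.distrib sum_distrib_right)
  finally have 1: "(\<Sum>i<m. l \<cdot> i * h i z) \<le> \<dots>" .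
  have 2: "(norm (x - x0))\<^sup>2 + 2 * ((x - x0) \<bullet> (z - x)) + (norm (z - x))\<^sup>2 = (norm (z - x0))\<^sup>2"
    unfolding power2_norm_eq_inner by (simp add: inner_diff_left inner_diff_right inner_commute)
  have 3: "(\<Sum>i<m. \<bar>l \<cdot> i\<bar>) = (\<Sum>i<m. l \<cdot> i)"
    using l by (intro sum.cong) (auto simp: nonneg_def)
  have 4: "smoothness m L l / 2 * (norm (z - x))\<^sup>2
      = (norm (z - x))\<^sup>2 + (\<Sum>i<m. l \<cdot> i) * (L / 2 * (norm (z - x))\<^sup>2)"
    unfolding smoothness_def 3 by (simp add: field_simps)
  show ?thesis
    using 1 2 unfolding 4 lagr_def lagr_grad_def by (simp add: inner_add_left inner_sum_left)
qed

text \<open>At \<open>x0\<close> the distance term has gradient zero, and \<open>x0\<close> belongs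
  to the hull, where constraint gradients are bounded by \<open>G\<close>.\<close>

lemma norm_lagr_grad_x0:
  assumes l: "l \<in> nonneg m"
  shows "norm (lagr_grad l x0) \<le> (\<Sum>i<m. l \<cdot> i) * G"
proof -
  have "norm (lagr_grad l x0) \<le> (\<Sum>i<m. norm (l \<cdot> i *\<^sub>R grad n (h i) x0))"
    unfolding lagr_grad_def by (simp add: norm_sum del: norm_scaleR)
  also have "\<dots> \<le> (\<Sum>i<m. l \<cdot> i * G)"
    using l by (intro sum_mono) (auto simp: nonneg_def intro!: mult_left_mono grad_bound hull_inc)
  finally show ?thesis by (simp add: sum_distrib_right)
qed

lemma smoothness_ge_2: "2 \<le> smoothness m L l"
  by (simp add: smoothness_def L_nonneg sum_nonneg)

text \<open>The gradient \<open>grad\<close> is known to be \<open>lagr_grad\<close> only at points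
  of \<open>Rn n\<close>, so the induction carries along that the query points stay there.\<close>

lemma agd_lagr_eq:
  "agd_lagr n m x0 h L l t = agd (lagr_grad l) 2 (smoothness m L l) x0 t"
proof -
  have "agd_lagr n m x0 h L l t = agd (lagr_grad l) 2 (smoothness m L l) x0 t \<and>
      snd (agd (lagr_grad l) 2 (smoothness m L l) x0 t) \<in> Rn n" for t
  proof (induction t)
    case (Suc t)
    have "snd (agd (lagr_grad l) 2 (smoothness m L l) x0 (Suc t)) \<in> Rn n"
      using agd_in_subspace[OF subspace_Rn x0_in, of "lagr_grad l"] lagr_grad_in by blast
    moreover have "agd_lagr n m x0 h L l (Suc t) = agd (lagr_grad l) 2 (smoothness m L l) x0 (Suc t)"
      using Suc grad_lagr unfolding agd_lagr_def by (simp add: Let_def case_prod_beta)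
    ultimately show ?case by blast
  qed (simp add: agd_lagr_def x0_in)
  then show ?thesis by blast
qed

lemma agd_lagr_in: "fst (agd_lagr n m x0 h L l t) \<in> Rn n" "snd (agd_lagr n m x0 h L l t) \<in> Rn n"
  unfolding agd_lagr_eq using agd_in_subspace[OF subspace_Rn x0_in, of "lagr_grad l"] lagr_grad_in by blast+

lemma agd_lagr_convergence:
  assumes l: "l \<in> nonneg m" and u: "u \<in> Rn n"
  shows "lagr m x0 h (fst (agd_lagr n m x0 h L l t)) l - lagr m x0 h u l
    \<le> (1 - 1 / sqrt (smoothness m L l / 2)) ^ t * ((\<Sum>i<m. l \<cdot> i) * G)\<^sup>2"
proof -
  have "lagr m x0 h (fst (agd_lagr n m x0 h L l t)) l - lagr m x0 h u l
    \<le> (1 - 1 / sqrt (smoothness m L l / 2)) ^ t * (norm (lagr_grad l x0))\<^sup>2"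
    unfolding agd_lagr_eq
    using agd_convergence_grad[of "Rn n" x0 u "lagr_grad l" "smoothness m L l" "\<lambda>x. lagr m x0 h x l" t]
      subspace_Rn x0_in u lagr_grad_in smoothness_ge_2 lagr_strongly_convex[OF l] lagr_smooth[OF l]
    by blast
  also have "\<dots> \<le> (1 - 1 / sqrt (smoothness m L l / 2)) ^ t * ((\<Sum>i<m. l \<cdot> i) * G)\<^sup>2"
    using smoothness_ge_2[of l] norm_lagr_grad_x0[OF l] by (intro mult_left_mono power_mono) auto
  finally show ?thesis .
qed

end

section \<open>Duality\<close>

context projection_setting
begin

abbreviation "dualf \<equiv> dual n m x0 h"

text \<open>The quadratic lower model at \<open>x0\<close>, minimized over the distance from
  \<open>x0\<close> by completing the square.\<close>

lemma lagr_ge: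
  assumes l: "l \<in> nonneg m" and x: "x \<in> Rn n"
  shows "(\<Sum>i<m. l \<cdot> i * h i x0) - ((\<Sum>i<m. l \<cdot> i) * G)\<^sup>2 / 4 \<le> lagr m x0 h x l"
proof -
  define a where "a = norm (lagr_grad l x0)"
  define r where "r = norm (x - x0)"
  have "- (a * r) \<le> lagr_grad l x0 \<bullet> (x - x0)"
    using norm_cauchy_schwarz[of "- lagr_grad l x0" "x - x0"] by (simp add: a_def r_def)
  moreover have "- (a * r) + r\<^sup>2 \<ge> - (a\<^sup>2 / 4)"
  proof -
    have "(r - a / 2)\<^sup>2 = r\<^sup>2 - a * r + a\<^sup>2 / 4" by (simp add: power2_eq_square algebra_simps)
    then show ?thesis using zero_le_power2[of "r - a / 2"] by linarith
  qed
  moreover have "a\<^sup>2 \<le> ((\<Sum>i<m. l \<cdot> i) * G)\<^sup>2"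
    unfolding a_def by (intro power_mono norm_lagr_grad_x0 l) simp
  moreover have "lagr m x0 h x0 l = (\<Sum>i<m. l \<cdot> i * h i x0)" by (simp add: lagr_def)
  ultimately show ?thesis
    using lagr_strongly_convex[OF l x0_in x] unfolding r_def by linarith
qed

lemma bdd_below_lagr: "l \<in> nonneg m \<Longrightarrow> bdd_below ((\<lambda>x. lagr m x0 h x l) ` Rn n)"
  by (rule bdd_belowI2) (rule lagr_ge)

lemma dual_le_lagr: "l \<in> nonneg m \<Longrightarrow> x \<in> Rn n \<Longrightarrow> dualf l \<le> lagr m x0 h x l"
  unfolding dual_def by (intro cINF_lower bdd_below_lagr)

lemma dual_geI: "(\<And>x. x \<in> Rn n \<Longrightarrow> c \<le> lagr m x0 h x l) \<Longrightarrow> c \<le> dualf l"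
  unfolding dual_def using x0_in by (intro cINF_greatest) auto

text \<open>Strong convexity is applied at the midpoint: the linear terms towards \<open>x\<close>
  and \<open>y\<close> cancel, and the value there is at least the infimum. No minimizer is
  presupposed, so the inequality can also prove that one exists.\<close>

lemma near_minimizers_close:
  assumes l: "l \<in> nonneg m" and x: "x \<in> Rn n" and y: "y \<in> Rn n"
  shows "(norm (x - y))\<^sup>2 \<le> 2 * lagr m x0 h x l + 2 * lagr m x0 h y l - 4 * dualf l"
proof -
  define c where "c = (1 / 2) *\<^sub>R (x + y)"
  have c: "c \<in> Rn n" unfolding c_def by (intro Rn_intros x y)
  have half: "(1 / 2) *\<^sub>R a + (1 / 2) *\<^sub>R a = a" for a :: vec by (simp flip: scaleR_add_left)
  have xc: "x - c = (1 / 2) *\<^sub>R (x - y)" and yc: "y - c = - ((1 / 2) *\<^sub>R (x - y))"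
    using half[of x] half[of y] unfolding c_def scaleR_add_right scaleR_diff_right
    by (simp_all add: diff_eq_eq eq_diff_eq add.commute)
  have "lagr m x0 h c l + lagr_grad l c \<bullet> (x - c) + (norm (x - y))\<^sup>2 / 4 \<le> lagr m x0 h x l"
    using lagr_strongly_convex[OF l c x] by (simp add: xc power_divide)
  moreover have "lagr m x0 h c l - lagr_grad l c \<bullet> (x - c) + (norm (x - y))\<^sup>2 / 4 \<le> lagr m x0 h y l"
    using lagr_strongly_convex[OF l c y] by (simp add: yc xc power_divide)
  ultimately show ?thesis using dual_le_lagr[OF l c] by simp
qed

lemma lagr_minimizer_exists:
  assumes l: "l \<in> nonneg m"
  obtains x where "x \<in> Rn n" "lagr m x0 h x l = dualf l"
proof -
  have "\<exists>x\<in>Rn n. lagr m x0 h x l < dualf l + inverse (Suc k)" for k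
    using cINF_less_iff[OF _ bdd_below_lagr[OF l], of "dualf l + inverse (Suc k)"] x0_in
    unfolding dual_def by auto
  then obtain X where X: "\<And>k. X k \<in> Rn n" "\<And>k. lagr m x0 h (X k) l < dualf l + inverse (Suc k)"
    by metis
  have "Cauchy X"
  proof (rule CauchyI)
    fix e :: real assume e: "0 < e"
    \<comment> \<open>Two points within \<open>\<gamma>\<close> of the infimum have squared distance
      at most \<open>4 * \<gamma>\<close>.\<close>
    then obtain M where M: "inverse (Suc M) < e\<^sup>2 / 4"
      using reals_Archimedean[of "e\<^sup>2 / 4"] by auto
    have "norm (X a - X b) < e" if "M \<le> a" "M \<le> b" for a b
    proof -
      have "inverse (Suc a) \<le> inverse (real (Suc M))" "inverse (Suc b) \<le> inverse (real (Suc M))"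
        using that by (intro le_imp_inverse_le; simp)+
      then have "(norm (X a - X b))\<^sup>2 < e\<^sup>2"
        using near_minimizers_close[OF l X(1)[of a] X(1)[of b]] X(2)[of a] X(2)[of b] M by linarith
      then show ?thesis using e by (simp add: power2_less_imp_less)
    qed
    then show "\<exists>M. \<forall>a\<ge>M. \<forall>b\<ge>M. norm (X a - X b) < e" by blast
  qed
  then obtain x where x: "x \<in> Rn n" "X \<longlonglongrightarrow> x"
    using complete_Rn X(1) unfolding complete_def by metis
  \<comment> \<open>The tangent at the limit \<open>x\<close> lies below the Lagrangian at every
    \<open>X k\<close> and tends to the value at \<open>x\<close>; this replaces continuity.\<close>
  have "lagr m x0 h x l \<le> dualf l"
  proof (rule LIMSEQ_le)
    show "(\<lambda>k. lagr m x0 h x l + lagr_grad l x \<bullet> (X k - x)) \<longlonglongrightarrow> lagr m x0 h x l"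
      by (rule tendsto_eq_intros x(2) refl)+ simp
    show "(\<lambda>k. dualf l + inverse (Suc k)) \<longlonglongrightarrow> dualf l"
      using tendsto_add[OF tendsto_const LIMSEQ_inverse_real_of_nat] by simp
    have "lagr m x0 h x l + lagr_grad l x \<bullet> (X k - x) \<le> dualf l + inverse (Suc k)" for k
      using lagr_strongly_convex[OF l x(1) X(1)[of k]] X(2)[of k] zero_le_power2[of "norm (X k - x)"]
      by linarith
    then show "\<exists>N. \<forall>k\<ge>N. lagr m x0 h x l + lagr_grad l x \<bullet> (X k - x) \<le> dualf l + inverse (Suc k)"
      by blast
  qed
  with dual_le_lagr[OF l x(1)] that x(1) show thesis by force
qed

section \<open>First-order optimality and strong duality\<close>

lemma lagr_shift:
  "lagr m x0 h x (l + s *\<^sub>R \<mu>) = lagr m x0 h x l + s * (\<Sum>i<m. \<mu> \<cdot> i * h i x)"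
  by (simp add: lagr_def lookup_add distrib_right sum.distrib sum_distrib_left mult.assoc)

text \<open>
  First-order optimality of the dual: moving the maximizer \<open>l\<close> to \<open>l + s \<mu>\<close> moves the minimizer of
  the Lagrangian by \<open>O(s)\<close>, by strong convexity, and hence \<open>(\<Sum>i<m. \<mu> \<cdot> i * h i x)\<close> is the
  derivative of the dual in direction \<open>\<mu>\<close>.
\<close>

lemma dual_maximizer_first_order:
  assumes l: "l \<in> nonneg m" and max: "\<And>l'. l' \<in> nonneg m \<Longrightarrow> dualf l' \<le> dualf l"
    and x: "x \<in> Rn n" "lagr m x0 h x l = dualf l"
    and \<mu>: "\<And>s. 0 < s \<Longrightarrow> s \<le> 1 \<Longrightarrow> l + s *\<^sub>R \<mu> \<in> nonneg m"
  shows "(\<Sum>i<m. \<mu> \<cdot> i * h i x) \<le> 0"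
proof -
  define \<psi> where "\<psi> y = (\<Sum>i<m. \<mu> \<cdot> i * h i y)" for y
  define A where "A = (\<Sum>i<m. \<bar>\<mu> \<cdot> i\<bar> * norm (grad n (h i) x))"
  define D where "D = (\<Sum>i<m. \<bar>\<mu> \<cdot> i\<bar> * (L / 2))"
  have A: "0 \<le> A" unfolding A_def by (intro sum_nonneg) auto
  have D: "0 \<le> D" unfolding D_def using L_nonneg by (intro sum_nonneg) auto
  have \<psi>: "\<psi> x - \<psi> y \<le> A * norm (y - x) + D * (norm (y - x))\<^sup>2" if y: "y \<in> Rn n" for y
  proof -
    have "\<bar>h i x - h i y\<bar> \<le> norm (grad n (h i) x) * norm (y - x) + L / 2 * (norm (y - x))\<^sup>2"
      if i: "i < m" for i
    proof -
      have "\<bar>grad n (h i) x \<bullet> (y - x)\<bar> \<le> norm (grad n (h i) x) * norm (y - x)"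
        by (rule Cauchy_Schwarz_ineq2)
      moreover have "0 \<le> L / 2 * (norm (y - x))\<^sup>2" using L_nonneg by simp
      ultimately show ?thesis
        using h_gradient_ineq[OF i x(1) y] h_smooth[OF i x(1) y] by linarith
    qed
    then have "\<mu> \<cdot> i * (h i x - h i y)
        \<le> \<bar>\<mu> \<cdot> i\<bar> * (norm (grad n (h i) x) * norm (y - x) + L / 2 * (norm (y - x))\<^sup>2)" if "i < m" for i
      using mult_left_mono[of "\<bar>h i x - h i y\<bar>" _ "\<bar>\<mu> \<cdot> i\<bar>"] abs_ge_self[of "\<mu> \<cdot> i * (h i x - h i y)"] that
      unfolding abs_mult by (meson abs_ge_zero order_trans)
    then have "(\<Sum>i<m. \<mu> \<cdot> i * (h i x - h i y))
        \<le> (\<Sum>i<m. \<bar>\<mu> \<cdot> i\<bar> * (norm (grad n (h i) x) * norm (y - x) + L / 2 * (norm (y - x))\<^sup>2))"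
      by (intro sum_mono) auto
    moreover have "\<psi> x - \<psi> y = (\<Sum>i<m. \<mu> \<cdot> i * (h i x - h i y))"
      by (simp add: \<psi>_def right_diff_distrib sum_subtractf)
    ultimately have "\<psi> x - \<psi> y
        \<le> (\<Sum>i<m. \<bar>\<mu> \<cdot> i\<bar> * (norm (grad n (h i) x) * norm (y - x) + L / 2 * (norm (y - x))\<^sup>2))"
      by simp
    also have "\<dots> = A * norm (y - x) + D * (norm (y - x))\<^sup>2"
      unfolding A_def D_def by (simp add: distrib_left sum.distrib sum_distrib_right mult.assoc)
    finally show ?thesis .
  qed
  \<comment> \<open>The bound on \<open>s * D\<close> lets half of \<open>r\<^sup>2\<close> absorb
    the quadratic term below, which leaves \<open>r\<close> of order \<open>s\<close>.\<close>
  have small: "\<psi> x \<le> s * (4 * A\<^sup>2 + 16 * D * A\<^sup>2)" if s: "0 < s" "s \<le> 1" "s * D \<le> 1 / 4" for s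
  proof -
    have ls: "l + s *\<^sub>R \<mu> \<in> nonneg m" by (rule \<mu>[OF s(1,2)])
    obtain y where y: "y \<in> Rn n" "lagr m x0 h y (l + s *\<^sub>R \<mu>) = dualf (l + s *\<^sub>R \<mu>)"
      using lagr_minimizer_exists[OF ls] by blast
    define r where "r = norm (y - x)"
    have r: "0 \<le> r" by (simp add: r_def)
    \<comment> \<open>The minimizer \<open>y\<close> for the shifted multiplier is only a competitor
      at \<open>l\<close>. Maximality of \<open>l\<close> then forces
      \<open>\<psi> y \<le> 0\<close>, and this is transferred to \<open>x\<close> because
      \<open>y\<close> is close to it.\<close>
    have le: "dualf l + s * \<psi> y \<le> dualf (l + s *\<^sub>R \<mu>)"
      using y(2) dual_le_lagr[OF l y(1)] by (simp add: lagr_shift \<psi>_def)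
    then have "s * \<psi> y \<le> 0" using max[OF ls] by linarith
    then have \<psi>y: "\<psi> y \<le> 0" using s by (simp add: mult_le_0_iff)
    have "r\<^sup>2 \<le> 2 * (lagr m x0 h x (l + s *\<^sub>R \<mu>) - dualf (l + s *\<^sub>R \<mu>))"
      using near_minimizers_close[OF ls y(1) x(1)] y(2) by (simp add: r_def)
    also have "\<dots> \<le> 2 * (s * (\<psi> x - \<psi> y))"
      using le x(2) by (simp add: lagr_shift \<psi>_def algebra_simps)
    also have "\<dots> \<le> 2 * (s * (A * r + D * r\<^sup>2))"
      using s \<psi>[OF y(1)] by (simp add: r_def)
    also have "\<dots> = 2 * s * A * r + 2 * (s * D) * r\<^sup>2" by (simp add: algebra_simps)
    also have "\<dots> \<le> 2 * s * A * r + r\<^sup>2 / 2"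
      using mult_right_mono[OF s(3), of "r\<^sup>2"] by simp
    finally have "r * r \<le> (4 * s * A) * r" by (simp add: power2_eq_square)
    then have rA: "r \<le> 4 * s * A"
      using r A s by (cases "r = 0") auto
    have "\<psi> x \<le> A * r + D * r\<^sup>2" using \<psi>[OF y(1)] \<psi>y by (simp add: r_def)
    also have "\<dots> \<le> A * (4 * s * A) + D * (4 * s * A)\<^sup>2"
      using rA r A D by (intro add_mono mult_left_mono power_mono) auto
    also have "\<dots> = 4 * s * A\<^sup>2 + s * s * (16 * D * A\<^sup>2)" by (simp add: power2_eq_square)
    also have "\<dots> \<le> 4 * s * A\<^sup>2 + s * 1 * (16 * D * A\<^sup>2)"
      using s A D by (intro add_left_mono mult_right_mono mult_left_mono) auto
    finally show ?thesis by (simp add: algebra_simps)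
  qed
  have "((\<lambda>s. s * (4 * A\<^sup>2 + 16 * D * A\<^sup>2)) \<longlongrightarrow> 0 * (4 * A\<^sup>2 + 16 * D * A\<^sup>2)) (at_right 0)"
    by (intro tendsto_intros)
  then have lim: "((\<lambda>s. s * (4 * A\<^sup>2 + 16 * D * A\<^sup>2)) \<longlongrightarrow> 0) (at_right 0)" by simp
  have "\<forall>\<^sub>F s in at_right 0. s \<in> {0<..<min 1 (1 / (4 * D + 1))}"
    using D by (intro eventually_at_right_real) auto
  then have "\<forall>\<^sub>F s in at_right 0. \<psi> x \<le> s * (4 * A\<^sup>2 + 16 * D * A\<^sup>2)"
  proof (rule eventually_mono)
    fix s :: real assume "s \<in> {0<..<min 1 (1 / (4 * D + 1))}"
    then have "0 < s" "s \<le> 1" "s < 1 / (4 * D + 1)" by auto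
    moreover from this have "s * (4 * D + 1) < 1" using D by (simp add: pos_less_divide_eq)
    ultimately have "0 < s" "s \<le> 1" "s * (4 * D + 1) < 1" by auto
    then show "\<psi> x \<le> s * (4 * A\<^sup>2 + 16 * D * A\<^sup>2)"
      using D by (intro small) (auto simp: algebra_simps)
  qed
  then have "\<psi> x \<le> 0" by (intro tendsto_lowerbound[OF lim]) auto
  then show ?thesis by (simp add: \<psi>_def)
qed

text \<open>Raising one multiplier shows that the minimizer \<open>xs\<close> is feasible; shrinking
  \<open>ls\<close> towards 0 shows that the weighted constraint sum at \<open>xs\<close> is
  nonnegative. Being also nonpositive, it vanishes, so the Lagrangian at \<open>xs\<close> is the
  squared distance.\<close>

lemma strong_duality:
  obtains ls xs where "ls \<in> box m R" "\<And>l. l \<in> nonneg m \<Longrightarrow> dualf l \<le> dualf ls"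
    "xs \<in> \<K>" "dualf ls = (norm (xs - x0))\<^sup>2"
    "\<And>x. x \<in> \<K> \<Longrightarrow> (norm (xs - x0))\<^sup>2 \<le> (norm (x - x0))\<^sup>2"
    "norm (xs - x0) \<le> B"
proof -
  obtain ls where ls: "dual_maximizer n m x0 h ls" "\<And>i. i < m \<Longrightarrow> \<bar>ls \<cdot> i\<bar> \<le> R"
    using problem by (auto simp: projection_problem_def)
  have nn: "ls \<in> nonneg m" and max: "\<And>l. l \<in> nonneg m \<Longrightarrow> dualf l \<le> dualf ls"
    using ls(1) by (auto simp: dual_maximizer_def is_arg_max_def not_less)
  have box: "ls \<in> box m R"
    using nn ls(2) by (force simp: nonneg_def box_def)
  obtain xs where xs: "xs \<in> Rn n" "lagr m x0 h xs ls = dualf ls"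
    using lagr_minimizer_exists[OF nn] by blast
  have le: "h i xs \<le> 0" if i: "i < m" for i
  proof -
    have "(\<Sum>j<m. Poly_Mapping.single i 1 \<cdot> j * h j xs) \<le> 0"
      using nn i by (intro dual_maximizer_first_order[OF nn max xs])
        (auto simp: nonneg_def lookup_add lookup_single when_def intro!: Rn_intros single_in_Rn)
    moreover have "(\<Sum>j<m. Poly_Mapping.single i 1 \<cdot> j * h j xs) = (\<Sum>j<m. if i = j then h j xs else 0)"
      by (intro sum.cong) (auto simp: lookup_single when_def)
    ultimately show ?thesis using i by simp
  qed
  have "(\<Sum>i<m. (- ls) \<cdot> i * h i xs) \<le> 0"
  proof (intro dual_maximizer_first_order[OF nn max xs])
    fix s :: real assume s: "0 < s" "s \<le> 1"
    have "ls + s *\<^sub>R - ls = (1 - s) *\<^sub>R ls" by (simp add: algebra_simps)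
    then show "ls + s *\<^sub>R - ls \<in> nonneg m"
      using nn s by (auto simp: nonneg_def intro!: Rn_intros)
  qed
  then have "0 \<le> (\<Sum>i<m. ls \<cdot> i * h i xs)" by (simp add: sum_negf)
  moreover have nonpos: "(\<Sum>i<m. ls \<cdot> i * h i x) \<le> 0" if "x \<in> \<K>" for x
    using that nn by (intro sum_nonpos mult_nonneg_nonpos) (auto simp: nonneg_def feasible_def)
  moreover have xsK: "xs \<in> \<K>" using xs(1) le by (auto simp: feasible_def)
  ultimately have d: "dualf ls = (norm (xs - x0))\<^sup>2"
    using xs(2) nonpos[OF xsK] by (simp add: lagr_def)
  have opt: "(norm (xs - x0))\<^sup>2 \<le> (norm (x - x0))\<^sup>2" if x: "x \<in> \<K>" for x
    using dual_le_lagr[OF nn, of x] nonpos[OF x] subsetD[OF feasible_subset x] d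
    unfolding lagr_def by linarith
  obtain xB where xB: "xB \<in> \<K>" "norm (xB - x0) \<le> B"
    using problem by (auto simp: projection_problem_def)
  have "norm (xs - x0) \<le> norm (xB - x0)"
    using opt[OF xB(1)] by (rule power2_le_imp_le) simp
  with xB(2) that[OF box max xsK d opt] show thesis by simp
qed

section \<open>Concavity and range of the dual, recovery of the projection\<close>

lemma dual_concave:
  assumes l: "l \<in> nonneg m" and \<mu>: "\<mu> \<in> nonneg m" and d: "0 \<le> d" "d \<le> 1"
  shows "(1 - d) * dualf l + d * dualf \<mu> \<le> dualf ((1 - d) *\<^sub>R l + d *\<^sub>R \<mu>)"
proof (rule dual_geI)
  fix x assume x: "x \<in> Rn n"
  have "lagr m x0 h x ((1 - d) *\<^sub>R l + d *\<^sub>R \<mu>) = (1 - d) * lagr m x0 h x l + d * lagr m x0 h x \<mu>"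
  proof -
    have "(\<Sum>i<m. ((1 - d) *\<^sub>R l + d *\<^sub>R \<mu>) \<cdot> i * h i x)
        = (1 - d) * (\<Sum>i<m. l \<cdot> i * h i x) + d * (\<Sum>i<m. \<mu> \<cdot> i * h i x)"
      by (simp add: lookup_add distrib_right sum.distrib sum_distrib_left mult.assoc)
    then show ?thesis unfolding lagr_def by algebra
  qed
  moreover have "(1 - d) * dualf l \<le> (1 - d) * lagr m x0 h x l" "d * dualf \<mu> \<le> d * lagr m x0 h x \<mu>"
    using d dual_le_lagr[OF l x] dual_le_lagr[OF \<mu> x] by (auto intro!: mult_left_mono)
  ultimately show "(1 - d) * dualf l + d * dualf \<mu> \<le> lagr m x0 h x ((1 - d) *\<^sub>R l + d *\<^sub>R \<mu>)"
    by linarith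
qed

text \<open>Limits what concavity can lose when the box is shrunk towards a maximizer. The
  constraints at \<open>x0\<close> are compared with those at a feasible point within distance
  \<open>B\<close>, which gives \<open>H + G * B\<close>; the squared term is that of
  \<open>lagr_ge\<close>.\<close>

lemma dual_box_lower:
  assumes \<mu>: "\<mu> \<in> box m R" and R: "0 \<le> R" "0 \<le> H"
  shows "- (m * R * (H + G * B) + (m * R * G)\<^sup>2 / 4) \<le> dualf \<mu>"
proof (rule dual_geI)
  fix x assume x: "x \<in> Rn n"
  have nn: "\<mu> \<in> nonneg m" using \<mu> by (auto simp: box_def nonneg_def)
  obtain xB where xB: "xB \<in> \<K>" "norm (xB - x0) \<le> B"
    using problem by (auto simp: projection_problem_def)
  have h0: "- (H + G * B) \<le> h i x0" if i: "i < m" for i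
  proof -
    have "\<bar>h i xB - h i x0\<bar> \<le> G * norm (xB - x0)"
      using lipschitz_onD[OF h_lipschitz[OF i], of xB x0] xB
      by (simp add: hull_inc dist_norm)
    also have "\<dots> \<le> G * B" using xB G_nonneg by (intro mult_left_mono)
    finally show ?thesis using h_bound[OF i xB(1)] by linarith
  qed
  have HGB: "0 \<le> H + G * B"
    using R G_nonneg order_trans[OF norm_ge_zero xB(2)] by simp
  have "(\<Sum>i<m. - (R * (H + G * B))) \<le> (\<Sum>i<m. \<mu> \<cdot> i * h i x0)"
  proof (rule sum_mono)
    fix i assume "i \<in> {..<m}"
    then have i: "i < m" and \<mu>i: "0 \<le> \<mu> \<cdot> i" "\<mu> \<cdot> i \<le> R" using \<mu> by (auto simp: box_def)
    have "\<mu> \<cdot> i * (H + G * B) \<le> R * (H + G * B)" using \<mu>i HGB by (intro mult_right_mono)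
    moreover have "- (\<mu> \<cdot> i * (H + G * B)) \<le> \<mu> \<cdot> i * h i x0"
      using mult_left_mono[OF h0[OF i] \<mu>i(1)] by (simp only: mult_minus_right)
    ultimately show "- (R * (H + G * B)) \<le> \<mu> \<cdot> i * h i x0" by linarith
  qed
  moreover have "(\<Sum>i<m. \<mu> \<cdot> i) \<le> m * R"
    using \<mu> sum_bounded_above[of "{..<m}" "\<lambda>i. \<mu> \<cdot> i" R] by (auto simp: box_def)
  then have "((\<Sum>i<m. \<mu> \<cdot> i) * G)\<^sup>2 \<le> (m * R * G)\<^sup>2"
    using nn G_nonneg by (intro power_mono mult_right_mono mult_nonneg_nonneg sum_nonneg) (auto simp: nonneg_def)
  ultimately show "- (m * R * (H + G * B) + (m * R * G)\<^sup>2 / 4) \<le> lagr m x0 h x \<mu>"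
    using lagr_ge[OF nn x] by simp
qed

text \<open>A feasible point has Lagrangian at most its squared distance, so \<open>xs\<close> is
  minimal up to \<open>2 * \<eta>\<close> and \<open>x\<close> up to \<open>\<eta>\<close>. The
  midpoint inequality doubles both.\<close>

lemma near_dual_optimal_imp_near_optimal:
  assumes l: "l \<in> nonneg m" and x: "x \<in> Rn n" and xs: "xs \<in> \<K>"
    and opt: "(norm (xs - x0))\<^sup>2 \<le> dualf l + 2 * \<eta>" "lagr m x0 h x l \<le> dualf l + \<eta>"
  shows "(norm (x - xs))\<^sup>2 \<le> 6 * \<eta>"
proof -
  have xsV: "xs \<in> Rn n" using xs feasible_subset by blast
  have "lagr m x0 h xs l \<le> (norm (xs - x0))\<^sup>2"
    unfolding lagr_def using xs l
    by (auto simp: feasible_def nonneg_def intro!: sum_nonpos mult_nonneg_nonpos)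
  then show ?thesis using near_minimizers_close[OF l x xsV] opt by linarith
qed

end

section \<open>The cutting plane argument\<close>

definition cube :: "nat \<Rightarrow> (nat \<Rightarrow> real) \<Rightarrow> real \<Rightarrow> vec set" where
  "cube m a d = {x \<in> Rn m. \<forall>i<m. a i \<le> x \<cdot> i \<and> x \<cdot> i \<le> a i + d}"

lemma box_eq_cube: "box m R = cube m (\<lambda>_. 0) R"
  by (simp add: box_def cube_def)

lemma coords_cube: "coords m (cube m a d) = (\<Pi>\<^sub>E i\<in>{..<m}. {a i..a i + d})"
proof (intro set_eqI iffI)
  fix f assume f: "f \<in> (\<Pi>\<^sub>E i\<in>{..<m}. {a i..a i + d})"
  then have "f = restrict (Poly_Mapping.lookup (mk_vec m f)) {..<m}"
    by (intro ext) (auto simp: lookup_mk_vec PiE_def extensional_def)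
  moreover have "mk_vec m f \<in> cube m a d"
    using f by (auto simp: cube_def mk_vec_in_Rn lookup_mk_vec PiE_def Pi_def)
  ultimately show "f \<in> coords m (cube m a d)" unfolding coords_def by (rule image_eqI)
qed (auto simp: coords_def cube_def PiE_def Pi_def)

lemma Vol_cube:
  assumes "0 \<le> d" shows "Vol m (cube m a d) = ennreal (d ^ m)"
proof -
  interpret product_sigma_finite "\<lambda>_ :: nat. lborel :: real measure"
    by unfold_locales
  have "(\<Pi>\<^sub>E i\<in>{..<m}. {a i..a i + d}) \<in> sets (\<Pi>\<^sub>M i\<in>{..<m}. lborel)"
    by (intro sets_PiM_I_finite) auto
  then have "Vol m (cube m a d) = (\<Prod>i<m. emeasure lborel {a i..a i + d})"
    unfolding Vol_def lebesgue_Rn_def coords_cube by (simp add: emeasure_PiM)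
  then show ?thesis using assms by (simp add: ennreal_power)
qed

text \<open>A nonmeasurable set has \<open>emeasure\<close> 0, so measurability of the larger set
  suffices.\<close>

lemma Vol_mono: "S \<subseteq> S' \<Longrightarrow> measurable_Rn m S' \<Longrightarrow> Vol m S \<le> Vol m S'"
  unfolding Vol_def measurable_Rn_def coords_def by (intro emeasure_mono image_mono) auto

text \<open>The point lies in \<open>M 1\<close>, so there is a round in which it disappears, and a
  round may only drop points on the positive side of its cut.\<close>

lemma fpm_run_excluded_point:
  assumes run: "fpm_run m R w T M lam" and p: "p \<in> box m R" "p \<notin> M (T + 1)"
  obtains t where "t \<in> {1..T}" "w (lam t) \<bullet> (p - lam t) > 0"
proof -
  have "\<exists>t\<in>{1..T}. p \<in> M t \<and> p \<notin> M (t + 1)"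
  proof (rule ccontr)
    assume *: "\<not> (\<exists>t\<in>{1..T}. p \<in> M t \<and> p \<notin> M (t + 1))"
    have "t \<le> T \<Longrightarrow> p \<in> M (t + 1)" for t
    proof (induction t)
      case 0
      then show ?case using run p(1) by (simp add: fpm_run_def)
    next
      case (Suc t)
      then show ?case using * by auto
    qed
    with p(2) show False by blast
  qed
  then obtain t where t: "t \<in> {1..T}" "p \<in> M t" "p \<notin> M (t + 1)" by blast
  then have "\<not> w (lam t) \<bullet> (p - lam t) \<le> 0"
    using run unfolding fpm_run_def by blast
  with t(1) that show thesis by force
qed

lemma fpm_run_in_Rn:
  assumes run: "fpm_run m R w T M lam" and t: "t \<in> {1..T}"
  shows "lam t \<in> Rn m"
proof (cases "t = 1")
  case True
  then show ?thesis using run by (simp add: fpm_run_def mk_vec_in_Rn)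
next
  case False
  then obtain s where "t = s + 1" "s \<in> {1..T}" using t by (cases t) auto
  then have "lam t \<in> M t" "measurable_Rn m (M t)" using run by (auto simp: fpm_run_def)
  then show ?thesis by (auto simp: measurable_Rn_def)
qed

text \<open>Hence a box point can only be removed by a round whose query lies in the box.\<close>

lemma oracle_s_separates:
  assumes "p \<in> box m R" shows "oracle_s m R l \<bullet> (p - l) \<le> 0"
proof -
  have "oracle_s m R l \<bullet> (p - l) = (\<Sum>i<m. oracle_s m R l \<cdot> i * (p \<cdot> i - l \<cdot> i))"
    by (subst inner_Rn[of _ m]) (simp_all add: oracle_s_def mk_vec_in_Rn lookup_minus)
  also have "\<dots> \<le> 0"
    using assms by (intro sum_nonpos) (auto simp: oracle_s_def lookup_mk_vec box_def)
  finally show ?thesis .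
qed

lemma oracle_s_nonzero:
  assumes l: "l \<in> Rn m" "l \<notin> box m R" and R: "0 \<le> R" shows "oracle_s m R l \<noteq> 0"
proof
  assume "oracle_s m R l = 0"
  obtain i where i: "i < m" "l \<cdot> i < 0 \<or> l \<cdot> i > R"
    using l by (auto simp: box_def not_le)
  have "oracle_s m R l \<cdot> i = 0" using \<open>oracle_s m R l = 0\<close> by simp
  with i show False by (auto simp: oracle_s_def lookup_mk_vec split: if_splits)
qed

context projection_setting
begin

lemma oracle_x_in: "oracle_x n m x0 h L N l \<in> Rn n"
  by (simp add: oracle_x_def agd_lagr_in)

text \<open>The Lagrangian is affine in the multiplier with slope \<open>h i x\<close>, so a cut
  compares two multipliers at the same point \<open>x\<close>.\<close>

lemma oracle_g_inner:
  "oracle_g n m x0 h L N l \<bullet> (p - l)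
    = lagr m x0 h (oracle_x n m x0 h L N l) p - oracle_v n m x0 h L N l"
proof -
  have "oracle_g n m x0 h L N l \<bullet> (p - l)
      = (\<Sum>i<m. h i (oracle_x n m x0 h L N l) * (p \<cdot> i - l \<cdot> i))"
    unfolding oracle_g_def by (subst inner_Rn[OF mk_vec_in_Rn]) (simp add: lookup_mk_vec lookup_minus)
  then show ?thesis
    by (simp add: lagr_def oracle_v_def left_diff_distrib sum_subtractf mult.commute[of "h _ _"])
qed

text \<open>If all constraints vanish at the oracle's point, the Lagrangian there does not depend on
  the multiplier and bounds the whole dual.\<close>

lemma dual_le_of_zero_cut:
  assumes l: "l \<in> nonneg m" and g: "oracle_g n m x0 h L N l' = 0"
  shows "dualf l \<le> oracle_v n m x0 h L N l'"
proof -
  have "oracle_g n m x0 h L N l' \<bullet> (l - l') = 0" by (simp add: g)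
  then show ?thesis using dual_le_lagr[OF l oracle_x_in, of N l'] by (simp add: oracle_g_inner)
qed

text \<open>
  The copy of the box shrunk by \<open>\<delta>\<close> towards the maximizer \<open>ls\<close> is larger than the last set \<open>M\<close>, so
  one of its points has been cut off.  By concavity the dual is nearly maximal at this point, and
  by the cut it is below the value found in that round.
\<close>

lemma cutting_plane_dual_gap:
  fixes M :: "nat \<Rightarrow> vec set" and lam :: "nat \<Rightarrow> vec" and N :: "vec \<Rightarrow> nat"
  defines "w \<equiv> fpm_cut n m x0 h L R N"
  assumes R: "0 < R" and ls: "ls \<in> box m R"
    and run: "fpm_run m R w T M lam" and rate: "cp_rate m w T M lam \<theta>"
    and out: "fpm_output m R (oracle_v n m x0 h L N) T lam lbar"
    and approx: "\<And>l z. l \<in> nonneg m \<Longrightarrow> z \<in> Rn n \<Longrightarrow>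
      lagr m x0 h (oracle_x n m x0 h L N l) l \<le> lagr m x0 h z l + \<eta>"
    and \<delta>: "0 < \<delta>" "\<delta> \<le> 1" "exp (- \<theta> * T) < \<delta> ^ m"
    and gap: "\<And>\<mu>. \<mu> \<in> box m R \<Longrightarrow> \<delta> * (dualf ls - dualf \<mu>) \<le> \<eta>" and \<eta>: "0 \<le> \<eta>"
  shows "dualf ls \<le> dualf lbar + 2 * \<eta>"
proof -
  have box_nn: "l \<in> nonneg m" if "l \<in> box m R" for l using that by (auto simp: box_def nonneg_def)
  have lbar: "lbar \<in> box m R" "lbar \<in> lam ` {1..T}"
    and best: "\<And>t. t \<in> {1..T} \<Longrightarrow> lam t \<in> box m R \<Longrightarrow>
      oracle_v n m x0 h L N (lam t) \<le> oracle_v n m x0 h L N lbar"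
    using out by (auto simp: fpm_output_def is_arg_max_def not_less)
  have T: "T \<in> {1..T}" using lbar(2) by auto
  \<comment> \<open>One \<open>\<eta>\<close> is lost here, since the oracle value may exceed the
    dual; the other is the loss from shrinking the box.\<close>
  have "oracle_v n m x0 h L N lbar - \<eta> \<le> dualf lbar"
    unfolding oracle_v_def using approx[OF box_nn[OF lbar(1)]] by (intro dual_geI) (simp add: algebra_simps)
  moreover have "\<exists>t\<in>{1..T}. lam t \<in> box m R \<and> dualf ls - \<eta> \<le> oracle_v n m x0 h L N (lam t)"
  proof (cases "\<exists>t\<in>{1..T}. w (lam t) = 0")
    \<comment> \<open>\<open>cp_rate\<close> promises nothing after a zero cut. Such a cut arises
      only inside the box, and its value already dominates the dual.\<close>
    case True
    then obtain t where t: "t \<in> {1..T}" "w (lam t) = 0" by blast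
    have box: "lam t \<in> box m R"
      using oracle_s_nonzero[OF fpm_run_in_Rn[OF run t(1)]] t(2) R
      by (auto simp: w_def fpm_cut_def split: if_splits)
    then have "oracle_g n m x0 h L N (lam t) = 0" using t(2) by (simp add: w_def fpm_cut_def)
    then show ?thesis using dual_le_of_zero_cut[OF box_nn[OF ls]] t(1) box \<eta> by force
  next
    case False
    then have "Vol m (M (T + 1)) \<le> ennreal (exp (- \<theta> * T)) * Vol m (M 1)"
      using rate T unfolding cp_rate_def by auto
    also have "\<dots> = ennreal (exp (- \<theta> * T) * R ^ m)"
      using run R by (simp add: fpm_run_def box_eq_cube Vol_cube ennreal_mult)
    also have "\<dots> < ennreal ((\<delta> * R) ^ m)"
      using \<delta> R by (intro ennreal_lessI) (auto simp: power_mult_distrib)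
    \<comment> \<open>This cube is the shrunk copy \<open>(1 - \<delta>) ls + \<delta> D\<close> of
      the box \<open>D\<close>.\<close>
    also have "\<dots> = Vol m (cube m (\<lambda>i. (1 - \<delta>) * ls \<cdot> i) (\<delta> * R))"
      using \<delta> R by (simp add: Vol_cube)
    finally have "\<not> cube m (\<lambda>i. (1 - \<delta>) * ls \<cdot> i) (\<delta> * R) \<subseteq> M (T + 1)"
      using run T Vol_mono unfolding fpm_run_def by (metis leD)
    then obtain p where p: "p \<in> cube m (\<lambda>i. (1 - \<delta>) * ls \<cdot> i) (\<delta> * R)" "p \<notin> M (T + 1)"
      by blast
    \<comment> \<open>The box point of which \<open>p\<close> is the shrunk image.\<close>
    define \<mu> where "\<mu> = (1 / \<delta>) *\<^sub>R (p - (1 - \<delta>) *\<^sub>R ls)"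
    have \<mu>: "\<mu> \<in> box m R"
      using p(1) ls \<delta> unfolding \<mu>_def
      by (auto simp: cube_def box_def lookup_minus divide_le_eq mult.commute intro!: Rn_intros divide_nonneg_pos)
    have p_eq: "p = (1 - \<delta>) *\<^sub>R ls + \<delta> *\<^sub>R \<mu>" using \<delta> by (simp add: \<mu>_def)
    have pbox: "p \<in> box m R"
    proof -
      have "0 \<le> (1 - \<delta>) * ls \<cdot> i" "(1 - \<delta>) * ls \<cdot> i \<le> (1 - \<delta>) * R" if "i < m" for i
        using ls that \<delta> by (auto simp: box_def intro!: mult_left_mono)
      then have "0 \<le> p \<cdot> i" "p \<cdot> i \<le> (1 - \<delta>) * R + \<delta> * R" if "i < m" for i
        using p(1) that unfolding cube_def by force+
      then show ?thesis using p(1) by (simp add: box_def cube_def algebra_simps)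
    qed
    obtain t where t: "t \<in> {1..T}" "w (lam t) \<bullet> (p - lam t) > 0"
      using fpm_run_excluded_point[OF run pbox p(2)] .
    have box: "lam t \<in> box m R"
      using t(2) oracle_s_separates[OF pbox, of "lam t"] by (auto simp: w_def fpm_cut_def split: if_splits)
    then have "lagr m x0 h (oracle_x n m x0 h L N (lam t)) p < oracle_v n m x0 h L N (lam t)"
      using t(2) by (simp add: w_def fpm_cut_def oracle_g_inner)
    then have "dualf p \<le> oracle_v n m x0 h L N (lam t)"
      using dual_le_lagr[OF box_nn[OF pbox] oracle_x_in, of N "lam t"] by linarith
    moreover have "dualf ls - \<eta> \<le> dualf p"
      using dual_concave[OF box_nn[OF ls] box_nn[OF \<mu>], of \<delta>] \<delta> gap[OF \<mu>] unfolding p_eq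
      by (simp add: algebra_simps)
    ultimately show ?thesis using t(1) box by force
  qed
  ultimately show ?thesis using best by force
qed

end

section \<open>Choice of the constants\<close>

lemma logO_ge_1: "1 \<le> logO x"
  by (simp add: logO_def)

lemma exp_neg_logO_le:
  assumes "0 < x" shows "exp (- logO x) \<le> 1 / x"
proof -
  have "exp (- logO x) \<le> exp (- ln x)" by (simp add: logO_def)
  then show ?thesis using assms by (simp add: exp_minus inverse_eq_divide)
qed

text \<open>The absolute value pays for a constant factor on either side of 1 while the added number
  of iterations stays nonnegative.\<close>

lemma exp_neg_abs_ln_le: "0 < x \<Longrightarrow> exp (- \<bar>ln x\<bar>) * x \<le> (1::real)"
  by (simp add: exp_minus field_simps) (metis abs_ge_self exp_le_cancel_iff exp_ln)

lemma power_one_minus_inverse_le: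
  assumes "1 \<le> (q::real)" shows "(1 - 1 / q) ^ N \<le> exp (- (N / q))"
proof -
  have "1 - 1 / q \<le> exp (- (1 / q))" using exp_ge_add_one_self[of "- (1 / q)"] by simp
  then have "(1 - 1 / q) ^ N \<le> exp (- (1 / q)) ^ N" using assms by (intro power_mono) auto
  then show ?thesis by (simp flip: exp_of_nat_mult)
qed

context projection_setting
begin

text \<open>In \<open>cI\<close>, the 2 turns the logarithm into the factor
  \<open>(e / (\<beta> * B))\<^sup>2\<close>, which cancels the \<open>\<beta>\<^sup>2\<close> of
  the initial gap and leaves \<open>e\<^sup>2\<close>. One \<open>e\<close> is the target; the other
  is at most \<open>e0\<close> and is absorbed, with the remaining constants and the wanted factor
  \<open>c\<close>, by the absolute logarithm.\<close>

lemma agd_accuracy: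
  assumes l: "l \<in> nonneg m" and u: "u \<in> Rn n" and B: "0 < B" and G: "0 < G" and c: "0 < c"
    and e: "0 < e" "e \<le> e0"
  defines "cI \<equiv> 2 + \<bar>ln (e0 * G\<^sup>2 / (B\<^sup>2 * L\<^sup>2 * c))\<bar>"
  shows "lagr m x0 h (oracle_x n m x0 h L (agd_iters cI m L B e) l) l \<le> lagr m x0 h u l + c * e"
proof -
  define \<beta> where "\<beta> = smoothness m L l"
  define S where "S = (\<Sum>i<m. l \<cdot> i)"
  define lg where "lg = logO (\<beta> * B / e)"
  define N where "N = agd_iters cI m L B e l"
  have S: "0 \<le> S" using l by (auto simp: S_def nonneg_def intro!: sum_nonneg)
  have \<beta>: "\<beta> = 2 + S * L" "2 \<le> \<beta>"
  proof -
    have "(\<Sum>i<m. \<bar>l \<cdot> i\<bar>) = S" unfolding S_def using l by (intro sum.cong) (auto simp: nonneg_def)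
    then show "\<beta> = 2 + S * L" by (simp add: \<beta>_def smoothness_def)
    show "2 \<le> \<beta>" unfolding \<beta>_def by (rule smoothness_ge_2)
  qed
  have cI: "2 \<le> cI" by (simp add: cI_def)
  have lg: "1 \<le> lg" unfolding lg_def by (rule logO_ge_1)
  have N: "cI * sqrt \<beta> * lg \<le> N"
    unfolding N_def agd_iters_def \<beta>_def[symmetric] lg_def[symmetric] by (rule real_nat_ceiling_ge)
  have "(1 - 1 / sqrt (\<beta> / 2)) ^ N * (S * G)\<^sup>2 \<le> c * e"
  proof (cases "L = 0")
    \<comment> \<open>Here \<open>\<beta> = 2\<close>, so the contraction factor is 0 and a single
      iteration is exact.\<close>
    case True
    have "0 < cI * sqrt \<beta> * lg" using cI \<beta> lg by simp
    then have "0 < N" using N by linarith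
    then show ?thesis using True \<beta> c e by (simp add: power_0_left)
  next
    case False
    then have L: "0 < L" using L_nonneg by simp
    have q: "1 \<le> sqrt (\<beta> / 2)" "sqrt (\<beta> / 2) \<le> sqrt \<beta>" using \<beta>(2) by auto
    define k where "k = \<bar>ln (e0 * G\<^sup>2 / (B\<^sup>2 * L\<^sup>2 * c))\<bar>"
    have "2 * lg + k \<le> cI * lg"
      using mult_left_mono[OF lg, of k] unfolding cI_def k_def[symmetric]
      by (simp add: k_def distrib_right)
    also have "\<dots> \<le> N / sqrt \<beta>" using N \<beta> by (simp add: pos_le_divide_eq mult_ac)
    also have "\<dots> \<le> N / sqrt (\<beta> / 2)" using q by (intro divide_left_mono) auto
    finally have "(1 - 1 / sqrt (\<beta> / 2)) ^ N \<le> exp (- (2 * lg + k))"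
      using power_one_minus_inverse_le[OF q(1), of N] by (meson exp_le_cancel_iff neg_le_iff_le order_trans)
    also have "\<dots> = exp (- lg) ^ 2 * exp (- k)"
      by (simp add: power2_eq_square flip: exp_add)
    also have "\<dots> \<le> (e / (\<beta> * B)) ^ 2 * exp (- k)"
      using exp_neg_logO_le[of "\<beta> * B / e"] \<beta> B e
      by (intro mult_right_mono power_mono) (auto simp: lg_def)
    finally have "(1 - 1 / sqrt (\<beta> / 2)) ^ N * (S * G)\<^sup>2 \<le> (e / (\<beta> * B)) ^ 2 * exp (- k) * (\<beta> / L * G)\<^sup>2"
      using S G \<beta> L by (intro mult_mono power_mono mult_right_mono) (auto simp: field_simps)
    also have "\<dots> = e * (exp (- k) * (e * G\<^sup>2 / (B\<^sup>2 * L\<^sup>2)))"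
      using \<beta> L B by (simp add: power_mult_distrib power_divide power2_eq_square)
    also have "\<dots> \<le> e * (exp (- k) * (e0 * G\<^sup>2 / (B\<^sup>2 * L\<^sup>2)))"
      using e by (intro mult_left_mono divide_right_mono mult_right_mono) auto
    also have "exp (- k) * (e0 * G\<^sup>2 / (B\<^sup>2 * L\<^sup>2)) \<le> c"
      using exp_neg_abs_ln_le[of "e0 * G\<^sup>2 / (B\<^sup>2 * L\<^sup>2 * c)"] e G B L c
      unfolding k_def by (simp add: field_simps)
    finally show ?thesis using e by (simp add: mult_ac)
  qed
  then show ?thesis
    using agd_lagr_convergence[OF l u, of N] unfolding oracle_x_def N_def[symmetric] \<beta>_def[symmetric] S_def[symmetric]
    by linarith
qed

text \<open>The right-hand base is the shrink factor. Its accuracy carries \<open>m ^ 6\<close> in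
  the denominator and the dual range another \<open>m\<^sup>2\<close>, which takes eight logarithms;
  the ninth makes the inequality strict. Of the resulting \<open>\<epsilon> ^ 8\<close>, four powers
  are the target and four are bounded by \<open>E ^ 4\<close>.\<close>

lemma exp_rounds_less:
  fixes \<epsilon> E c A \<theta> :: real and T :: nat
  assumes R: "1 \<le> R" and G: "0 < G" and c: "0 < c" and A: "0 < A" and \<epsilon>: "0 < \<epsilon>" "\<epsilon> \<le> E" and \<theta>: "0 < \<theta>"
    and T: "(9 + \<bar>ln (E ^ 4 * (256 * (R * G) ^ 6 * A / c))\<bar>) * (m / \<theta>) * logO (m * R / \<epsilon>) \<le> T"
  shows "exp (- \<theta> * T) < (c * (\<epsilon> ^ 4 / (256 * (m * R * G) ^ 6)) / (A * (real m)\<^sup>2)) ^ m"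
proof -
  define k where "k = \<bar>ln (E ^ 4 * (256 * (R * G) ^ 6 * A / c))\<bar>"
  define lg where "lg = logO (m * R / \<epsilon>)"
  define Q where "Q = 256 * (R * G) ^ 6 * A / c"
  have m: "1 \<le> real m" using m_pos by simp
  have Q: "0 < Q" using R G c A by (simp add: Q_def)
  have k: "k = \<bar>ln (E ^ 4 * Q)\<bar>" by (simp add: k_def Q_def)
  have "(9 + k) * lg * m \<le> \<theta> * T"
    using mult_left_mono[OF T, of \<theta>] \<theta> by (simp add: k_def lg_def mult_ac)
  then have "exp (- \<theta> * T) \<le> exp (real m * - ((9 + k) * lg))"
    by (simp add: mult_ac)
  also have "\<dots> = exp (- ((9 + k) * lg)) ^ m" by (rule exp_of_nat_mult)
  also have "\<dots> < (\<epsilon> ^ 4 / (Q * real m ^ 8)) ^ m"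
  proof (rule power_strict_mono)
    have "8 * lg + 1 + k \<le> (9 + k) * lg"
      using mult_left_mono[OF logO_ge_1, of "1 + k" "m * R / \<epsilon>"] by (simp add: lg_def k_def algebra_simps)
    then have "exp (- ((9 + k) * lg)) < exp (- (8 * lg + k))"
      by simp
    also have "\<dots> = exp (- lg) ^ 8 * exp (- k)" by (simp add: mult_exp_exp flip: exp_of_nat_mult)
    also have "\<dots> \<le> (\<epsilon> / (m * R)) ^ 8 * exp (- k)"
      using exp_neg_logO_le[of "m * R / \<epsilon>"] m R \<epsilon> by (intro mult_right_mono power_mono) (auto simp: lg_def)
    also have "\<dots> \<le> (\<epsilon> / m) ^ 8 * exp (- k)"
      using m R \<epsilon> by (intro mult_right_mono power_mono divide_left_mono) auto
    also have "\<dots> = \<epsilon> ^ 4 / real m ^ 8 * (\<epsilon> ^ 4 * exp (- k))"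
      by (simp add: power_divide flip: power_add)
    also have "\<dots> \<le> \<epsilon> ^ 4 / real m ^ 8 * (E ^ 4 * exp (- k))"
      using m \<epsilon> by (intro mult_left_mono mult_right_mono power_mono) auto
    also have "\<dots> \<le> \<epsilon> ^ 4 / real m ^ 8 * (1 / Q)"
      using exp_neg_abs_ln_le[of "E ^ 4 * Q"] \<epsilon> Q m
      by (intro mult_left_mono) (auto simp: k field_simps)
    finally show "exp (- ((9 + k) * lg)) < \<epsilon> ^ 4 / (Q * real m ^ 8)" by (simp add: mult.commute)
  qed (use m_pos in auto)
  also have "\<epsilon> ^ 4 / (Q * real m ^ 8) = c * (\<epsilon> ^ 4 / (256 * (m * R * G) ^ 6)) / (A * (real m)\<^sup>2)"
  proof -
    have "real m ^ 8 = real m ^ 6 * (real m)\<^sup>2" by (simp flip: power_add)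
    then show ?thesis using c by (simp add: Q_def power_mult_distrib mult_ac)
  qed
  finally show ?thesis .
qed

lemma dual_gap_le:
  assumes "1 \<le> R" "0 \<le> H" "0 < B" "0 \<le> G"
    and "\<mu> \<in> box m R" "dualf ls = (norm (xs - x0))\<^sup>2" "norm (xs - x0) \<le> B"
  shows "dualf ls - dualf \<mu> \<le> (B\<^sup>2 + R * (H + G * B) + (R * G)\<^sup>2 / 4) * (real m)\<^sup>2"
proof -
  have m: "1 \<le> real m" "real m \<le> (real m)\<^sup>2" using m_pos by (auto simp: power2_eq_square)
  have 1: "dualf ls \<le> B\<^sup>2" using assms by (simp add: power_mono)
  have "B\<^sup>2 * 1 \<le> B\<^sup>2 * (real m)\<^sup>2" using m by (intro mult_left_mono) auto
  moreover have "R * (H + G * B) * m \<le> R * (H + G * B) * (real m)\<^sup>2" using m assms by (intro mult_left_mono) auto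
  ultimately show ?thesis
    using 1 dual_box_lower[OF assms(5)] assms(1,2) by (simp add: power_mult_distrib algebra_simps)
qed

text \<open>The summands of the divisor pay separately, with \<open>r\<close> the distance to
  \<open>xs\<close>: \<open>G\<close> for the slope of a constraint, \<open>L * E\<close> for its
  curvature, \<open>2 * B\<close> and \<open>E\<close> for the cross and square terms of the
  objective, and 1 for \<open>r \<le> \<epsilon> \<le> E\<close>, which makes
  \<open>r\<^sup>2\<close> linear in \<open>r\<close>.\<close>

lemma near_optimal_imp_guarantee:
  assumes x: "x \<in> Rn n" and xs: "xs \<in> \<K>" "norm (xs - x0) \<le> B" and G: "0 < G"
    and opt: "\<And>y. y \<in> \<K> \<Longrightarrow> (norm (xs - x0))\<^sup>2 \<le> (norm (y - x0))\<^sup>2"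
    and \<epsilon>: "0 < \<epsilon>" "\<epsilon> \<le> E"
    and close: "(norm (x - xs))\<^sup>2 \<le> (\<epsilon> / (G + L * E + 2 * B + E + 1))\<^sup>2"
  shows "\<forall>y\<in>\<K>. (norm (x - x0))\<^sup>2 \<le> (norm (y - x0))\<^sup>2 + 6 * \<epsilon>" "\<forall>i<m. h i x \<le> \<epsilon>"
proof -
  define r where "r = norm (x - xs)"
  define P where "P = G + L * E + 2 * B + E + 1"
  have B: "0 \<le> B" using xs(2) norm_ge_zero order_trans by blast
  have LE: "0 \<le> L * E" using L_nonneg \<epsilon> by simp
  have P: "1 \<le> P" using G LE B \<epsilon> by (simp add: P_def)
  have r: "0 \<le> r" by (simp add: r_def)
  have "r \<le> \<epsilon> / P" by (rule power2_le_imp_le[OF close[folded r_def P_def]]) (use P \<epsilon> in simp)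
  then have rP: "r * P \<le> \<epsilon>" using P by (simp add: pos_le_divide_eq)
  have "r * 1 \<le> r * P" using r P by (intro mult_left_mono) auto
  then have rE: "r \<le> E" using rP \<epsilon> by linarith
  have r2: "r\<^sup>2 \<le> r * E" using r rE by (simp add: power2_eq_square mult_left_mono)
  have sum: "r * G + r * (L * E) + 2 * (r * B) + r * E + r \<le> \<epsilon>"
    using rP by (simp add: P_def algebra_simps)
  have pos: "0 \<le> r * G" "0 \<le> r * (L * E)" "0 \<le> r * B" "0 \<le> r * E"
    using r G LE B \<epsilon> by auto
  show "\<forall>y\<in>\<K>. (norm (x - x0))\<^sup>2 \<le> (norm (y - x0))\<^sup>2 + 6 * \<epsilon>"
  proof
    fix y assume y: "y \<in> \<K>"
    have "norm (x - x0) \<le> r + norm (xs - x0)"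
      using norm_triangle_ineq[of "x - xs" "xs - x0"] by (simp add: r_def)
    then have "(norm (x - x0))\<^sup>2 \<le> (r + norm (xs - x0))\<^sup>2" by (intro power_mono) auto
    also have "\<dots> = r\<^sup>2 + 2 * (r * norm (xs - x0)) + (norm (xs - x0))\<^sup>2"
      by (simp add: power2_sum)
    also have "r * norm (xs - x0) \<le> r * B" using xs(2) r by (intro mult_left_mono)
    finally show "(norm (x - x0))\<^sup>2 \<le> (norm (y - x0))\<^sup>2 + 6 * \<epsilon>"
      using r2 sum pos opt[OF y] \<epsilon> r by linarith
  qed
  show "\<forall>i<m. h i x \<le> \<epsilon>"
  proof (intro allI impI)
    fix i assume i: "i < m"
    have xsV: "xs \<in> Rn n" using xs(1) feasible_subset by blast
    have "grad n (h i) xs \<bullet> (x - xs) \<le> norm (grad n (h i) xs) * r"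
      unfolding r_def by (rule norm_cauchy_schwarz)
    also have "\<dots> \<le> G * r" using xs(1) r by (intro mult_right_mono grad_bound i hull_inc) auto
    finally have "h i x \<le> h i xs + r * G + L / 2 * r\<^sup>2"
      using h_smooth[OF i xsV x] by (simp add: r_def mult.commute)
    moreover have "h i xs \<le> 0" using xs(1) i by (auto simp: feasible_def)
    moreover have "L / 2 * r\<^sup>2 \<le> L / 2 * (r * E)" using r2 L_nonneg by (intro mult_left_mono) auto
    moreover have "L / 2 * (r * E) = r * (L * E) / 2" by simp
    ultimately show "h i x \<le> \<epsilon>" using sum pos r by linarith
  qed
qed

end

section \<open>Running time\<close>

lemma le_mult_of_one_le: "0 \<le> a \<Longrightarrow> 1 \<le> b \<Longrightarrow> a \<le> a * (b::real)"
  using mult_left_mono[of 1 b a] by simp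

context projection_setting
begin

lemma agd_iters_le:
  fixes \<epsilon> E cI :: real
  assumes R: "1 \<le> R" and B: "0 < B" and G: "0 < G" and cI: "0 < cI"
    and \<epsilon>: "0 < \<epsilon>" "\<epsilon> \<le> E" and l: "l \<in> box m R"
  defines "a \<equiv> cI * sqrt (2 + R * L) * (8 + \<bar>ln ((2 + R * L) * B * 256 * (R * G) ^ 6)\<bar> + 3 * \<bar>ln E\<bar>) + 1"
  shows "agd_iters cI m L B (\<epsilon> ^ 4 / (256 * (m * R * G) ^ 6)) l \<le> a * (sqrt m * logO (m / \<epsilon>))"
proof -
  define b where "b = 2 + R * L"
  define Q where "Q = b * B * 256 * (R * G) ^ 6"
  define lg where "lg = logO (m / \<epsilon>)"
  define \<beta> where "\<beta> = smoothness m L l"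
  define e where "e = \<epsilon> ^ 4 / (256 * (m * R * G) ^ 6)"
  have m: "1 \<le> real m" using m_pos by simp
  have b: "2 \<le> b" using R L_nonneg by (simp add: b_def)
  have Q: "0 < Q" using b B G R by (simp add: Q_def)
  have e: "0 < e" using m R G \<epsilon> by (simp add: e_def)
  have lg: "1 \<le> lg" unfolding lg_def by (rule logO_ge_1)
  have \<beta>2: "2 \<le> \<beta>" unfolding \<beta>_def by (rule smoothness_ge_2)
  have \<beta>b: "\<beta> \<le> m * b"
  proof -
    have "(\<Sum>i<m. \<bar>l \<cdot> i\<bar>) \<le> m * R"
      using l sum_bounded_above[of "{..<m}" "\<lambda>i. \<bar>l \<cdot> i\<bar>" R] by (auto simp: box_def)
    then have "(\<Sum>i<m. \<bar>l \<cdot> i\<bar>) * L \<le> m * R * L" using L_nonneg by (intro mult_right_mono)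
    then show ?thesis using m by (simp add: \<beta>_def smoothness_def b_def algebra_simps)
  qed
  have log: "logO (\<beta> * B / e) \<le> (8 + \<bar>ln Q\<bar> + 3 * \<bar>ln E\<bar>) * lg"
  proof -
    have "\<beta> * B / e \<le> m * b * B / e" using \<beta>b B e by (intro divide_right_mono mult_right_mono) auto
    \<comment> \<open>One \<open>m\<close> comes from \<open>\<beta>\<close>, six from the accuracy.
      Writing the inverse fourth power of \<open>\<epsilon>\<close> as a seventh times
      \<open>\<epsilon> ^ 3\<close> leaves a power of \<open>m / \<epsilon>\<close>; the logarithm
      of \<open>\<epsilon> ^ 3\<close> is bounded through \<open>E\<close>.\<close>
    also have "\<dots> = Q * (m / \<epsilon>) ^ 7 * \<epsilon> ^ 3"
    proof -
      have "real m * real m ^ 6 = real m ^ 7" "\<epsilon> ^ 7 = \<epsilon> ^ 4 * \<epsilon> ^ 3" by (simp_all flip: power_Suc power_add)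
      then show ?thesis using \<epsilon>
        by (simp add: Q_def e_def power_mult_distrib power_divide divide_simps mult_ac)
    qed
    finally have le: "\<beta> * B / e \<le> Q * (m / \<epsilon>) ^ 7 * \<epsilon> ^ 3" .
    have "0 < \<beta> * B / e" using \<beta>2 B e by simp
    then have "ln (\<beta> * B / e) \<le> ln (Q * (m / \<epsilon>) ^ 7 * \<epsilon> ^ 3)"
      using le ln_le_cancel_iff[THEN iffD2, OF _ _ le] by linarith
    also have "\<dots> = ln Q + 7 * ln (m / \<epsilon>) + 3 * ln \<epsilon>"
      using Q m \<epsilon> by (simp add: ln_mult ln_realpow)
    also have "\<dots> \<le> \<bar>ln Q\<bar> + 7 * lg + 3 * \<bar>ln E\<bar>"
    proof -
      have "ln \<epsilon> \<le> ln E" using \<epsilon> by simp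
      moreover have "ln (m / \<epsilon>) \<le> lg" by (simp add: lg_def logO_def)
      ultimately show ?thesis by linarith
    qed
    finally have "logO (\<beta> * B / e) \<le> 8 * lg + (\<bar>ln Q\<bar> + 3 * \<bar>ln E\<bar>)"
      using lg unfolding logO_def[of "\<beta> * B / e"] by simp
    also have "\<dots> \<le> 8 * lg + (\<bar>ln Q\<bar> + 3 * \<bar>ln E\<bar>) * lg"
      using lg by (intro add_left_mono le_mult_of_one_le) auto
    finally show ?thesis by (simp add: algebra_simps)
  qed
  have "agd_iters cI m L B e l \<le> cI * sqrt \<beta> * logO (\<beta> * B / e) + 1"
  proof -
    have "0 \<le> cI * sqrt \<beta> * logO (\<beta> * B / e)"
      using cI \<beta>2 logO_ge_1[of "\<beta> * B / e"] by simp
    then show ?thesis unfolding agd_iters_def \<beta>_def[symmetric] by linarith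
  qed
  also have "\<dots> \<le> cI * sqrt (m * b) * ((8 + \<bar>ln Q\<bar> + 3 * \<bar>ln E\<bar>) * lg) + sqrt m * lg"
  proof (intro add_mono mult_mono mult_left_mono log)
    show "1 \<le> sqrt m * lg" using m lg mult_mono[of 1 "sqrt m" 1 lg] by simp
    show "0 \<le> logO (\<beta> * B / e)" using logO_ge_1[of "\<beta> * B / e"] by simp
  qed (use cI \<beta>b \<beta>2 b in auto)
  also have "\<dots> = a * (sqrt m * lg)"
    unfolding a_def b_def[symmetric] Q_def[symmetric] by (simp add: real_sqrt_mult algebra_simps)
  finally show ?thesis unfolding e_def lg_def .
qed

lemma oracle_x_time_le:
  fixes c a s :: real
  assumes N: "N l \<le> a * s" and cost: "eval_cost n m c cv cg" and a: "0 \<le> a" and c: "0 \<le> c" and s: "1 \<le> s"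
  shows "oracle_x_time n m x0 h L N cg l \<le> (22 + a * (c + 9)) * (n * m * s)"
proof -
  have nm: "1 \<le> real n" "1 \<le> real m" using n_pos m_pos by auto
  have le: "1 \<le> real n * m" "real n \<le> real n * m" "real m \<le> real n * m"
    using mult_mono[OF nm] le_mult_of_one_le[of n m] le_mult_of_one_le[of m n] nm by (simp_all add: mult.commute)
  have "lagr_grad_time n m cg x + 5 * n \<le> (c + 9) * (n * m)" if "x \<in> Rn n" for x
  proof -
    have "(\<Sum>i<m. cg i x + 2 * n) \<le> (\<Sum>i<m. c * n + 2 * n)"
      using cost that by (intro sum_mono) (auto simp: eval_cost_def)
    then have "lagr_grad_time n m cg x + 5 * n \<le> 7 * n + (c + 2) * (n * m)"
      by (simp add: lagr_grad_time_def algebra_simps)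
    also have "\<dots> \<le> 7 * (n * m) + (c + 2) * (n * m)" using le by simp
    finally show ?thesis by (simp add: algebra_simps)
  qed
  then have "(\<Sum>t<N l. lagr_grad_time n m cg (snd (agd_lagr n m x0 h L l t)) + 5 * n)
      \<le> (\<Sum>t<N l. (c + 9) * (n * m))"
    by (intro sum_mono) (simp add: agd_lagr_in)
  also have "\<dots> = N l * ((c + 9) * (n * m))" by simp
  also have "\<dots> \<le> a * s * ((c + 9) * (n * m))" using N c by (intro mult_right_mono) auto
  finally have "oracle_x_time n m x0 h L N cg l \<le> 22 * (n * m) + a * s * ((c + 9) * (n * m))"
    unfolding oracle_x_time_def using le by simp
  also have "\<dots> \<le> 22 * (n * m * s) + a * s * ((c + 9) * (n * m))"
    using le_mult_of_one_le[of "real n * m" s] s by simp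
  finally show ?thesis by (simp add: algebra_simps)
qed

text \<open>The cost of an oracle call is counted twice because the call for the output is charged
  to the rounds, of which there is at least one.\<close>

lemma fpm_time_le:
  fixes c a s \<tau> :: real and T :: nat
  assumes N: "\<And>l. l \<in> box m R \<Longrightarrow> N l \<le> a * s" and cost: "eval_cost n m c cv cg"
    and a: "0 \<le> a" and c: "0 \<le> c" and s: "1 \<le> s"
    and u: "\<And>t. t \<in> {1..T} \<Longrightarrow> u t \<le> \<tau>" and lbar: "lbar \<in> box m R" and T: "1 \<le> T"
  shows "fpm_time n m x0 h L R N cv cg T lam u lbar
    \<le> T * ((2 * (22 + a * (c + 9)) + c + 10) * (n * m * s)) + T * \<tau>"
proof -
  define W where "W = n * m * s"
  define C1 where "C1 = 22 + a * (c + 9)"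
  have nm: "1 \<le> real n" "1 \<le> real m" using n_pos m_pos by auto
  have nmW: "real n * m \<le> W" unfolding W_def using le_mult_of_one_le[of "real n * m" s] s by simp
  have W: "1 \<le> W" "real n \<le> W" "real m \<le> W"
    using le_mult_of_one_le[of n m] le_mult_of_one_le[of m n] nm nmW
    unfolding mult.commute[of "real m" "real n"] by linarith+
  have C1: "0 \<le> C1" using a c by (simp add: C1_def)
  have x_time: "oracle_x_time n m x0 h L N cg l \<le> C1 * W" if "l \<in> box m R" for l
    unfolding C1_def W_def using oracle_x_time_le[of N l a s c cv cg] N[OF that] cost a c s by blast
  have val_time: "(\<Sum>i<m. cv i x) \<le> c * W" if "x \<in> Rn n" for x
  proof -
    have "(\<Sum>i<m. cv i x) \<le> (\<Sum>i<m. c * n)" using cost that by (intro sum_mono) (auto simp: eval_cost_def)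
    also have "\<dots> = c * (real n * m)" by simp
    also have "\<dots> \<le> c * W" using nmW c by (intro mult_left_mono)
    finally show ?thesis .
  qed
  have "(\<Sum>t=1..T. 2 * real m +
        (if lam t \<in> box m R
         then oracle_x_time n m x0 h L N cg (lam t)
              + (\<Sum>i<m. cv i (oracle_x n m x0 h L N (lam t))) + m + (3 * real n + 2 * real m) + 1
         else m) + u t) \<le> (\<Sum>t=1..T. (C1 + c + 9) * W + \<tau>)"
  proof (rule sum_mono)
    fix t assume t: "t \<in> {1..T}"
    have "(if lam t \<in> box m R
         then oracle_x_time n m x0 h L N cg (lam t)
              + (\<Sum>i<m. cv i (oracle_x n m x0 h L N (lam t))) + m + (3 * real n + 2 * real m) + 1
         else m) \<le> C1 * W + c * W + 7 * W"
    proof (cases "lam t \<in> box m R")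
      case True
      then show ?thesis using x_time[OF True] val_time[OF oracle_x_in, of N "lam t"] W by simp
    next
      case False
      then show ?thesis using W mult_nonneg_nonneg[OF C1, of W] mult_nonneg_nonneg[OF c, of W] by auto
    qed
    then show "2 * real m +
        (if lam t \<in> box m R
         then oracle_x_time n m x0 h L N cg (lam t)
              + (\<Sum>i<m. cv i (oracle_x n m x0 h L N (lam t))) + m + (3 * real n + 2 * real m) + 1
         else m) + u t \<le> (C1 + c + 9) * W + \<tau>"
      using u[OF t] W by (simp add: distrib_right)
  qed
  also have "\<dots> = T * ((C1 + c + 9) * W) + T * \<tau>" by (simp add: distrib_left)
  finally have "fpm_time n m x0 h L R N cv cg T lam u lbar
      \<le> W + (T * ((C1 + c + 9) * W) + T * \<tau>) + C1 * W"
    unfolding fpm_time_def using x_time[OF lbar] W by linarith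
  also have "\<dots> = (C1 + 1) * W + T * ((C1 + c + 9) * W) + T * \<tau>" by (simp add: distrib_right)
  also have "(C1 + 1) * W \<le> T * ((C1 + 1) * W)"
    using le_mult_of_one_le[of "(C1 + 1) * W" T] T C1 W by (simp add: mult.commute)
  finally show ?thesis unfolding C1_def W_def by (simp add: algebra_simps)
qed

text \<open>The exponent 2.5 collects \<open>m\<close> from the rounds, \<open>m\<close> from each
  gradient of the Lagrangian and \<open>sqrt m\<close> from the descent iterations. The first term
  must not contain \<open>R\<close> in its logarithm, hence the factor \<open>1 + ln R\<close>.
  Since \<open>\<theta> \<le> ln 2 \<le> 1\<close>, the ceiling in \<open>T\<close> costs at most
  another \<open>m / \<theta>\<close> times the logarithm.\<close>

lemma running_time:
  fixes c a \<epsilon> \<tau> cT \<theta> :: real and T :: nat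
  assumes N: "\<And>l. l \<in> box m R \<Longrightarrow> N l \<le> a * (sqrt m * logO (m / \<epsilon>))" and cost: "eval_cost n m c cv cg"
    and a: "0 \<le> a" and c: "0 \<le> c" and cT: "0 < cT" and R: "1 \<le> R" and \<epsilon>: "0 < \<epsilon>"
    and \<theta>: "0 < \<theta>" "\<theta> \<le> ln 2" and T: "T = nat \<lceil>cT * (m / \<theta>) * logO (m * R / \<epsilon>)\<rceil>"
    and u: "\<forall>t\<in>{1..T}. 0 \<le> u t \<and> u t \<le> \<tau>" and lbar: "lbar \<in> box m R"
  shows "fpm_time n m x0 h L R N cv cg T lam u lbar
    \<le> (cT + 1) * (1 + ln R) * (2 * (22 + a * (c + 9)) + c + 10) *
      (n * m powr 2.5 * (1 / \<theta>) * (logO (m / \<epsilon>))\<^sup>2 + \<tau> * m * (1 / \<theta>) * logO (m * R / \<epsilon>))"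
proof -
  define lg where "lg = logO (m / \<epsilon>)"
  define lg' where "lg' = logO (m * R / \<epsilon>)"
  define C2 where "C2 = 2 * (22 + a * (c + 9)) + c + 10"
  define K where "K = (cT + 1) * (1 + ln R) * C2"
  have m: "1 \<le> real m" using m_pos by simp
  have lg: "1 \<le> lg" "1 \<le> lg'" unfolding lg_def lg'_def by (rule logO_ge_1)+
  have lnR: "0 \<le> ln R" using R by simp
  have "ln (m * R / \<epsilon>) = ln (m / \<epsilon>) + ln R" using m R \<epsilon> by (simp add: ln_mult ln_div)
  then have "lg' \<le> lg + ln R"
    using lnR unfolding lg_def lg'_def logO_def by linarith
  also have "\<dots> \<le> lg + ln R * lg" using lg lnR by (intro add_left_mono le_mult_of_one_le)
  finally have lg'_le: "lg' \<le> (1 + ln R) * lg" by (simp add: algebra_simps)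
  have "ln 2 \<le> (1::real)" using ln_le_minus_one[of "2::real"] by simp
  then have "\<theta> \<le> 1" using \<theta> by linarith
  then have "1 \<le> m / \<theta>" using m \<theta> by (simp add: pos_le_divide_eq)
  then have mlg: "1 \<le> m / \<theta> * lg'" using lg mult_mono[of 1 "m / \<theta>" 1 lg'] by simp
  have "0 < cT * (m / \<theta>) * lg'" using cT mlg mult_pos_pos[of cT "m / \<theta> * lg'"] by (simp add: mult.assoc)
  then have T1: "1 \<le> T" and T_le: "T \<le> cT * (m / \<theta>) * lg' + 1"
    unfolding T lg'_def[symmetric] by linarith+
  have "(cT + 1) * (m / \<theta> * lg') = cT * (m / \<theta>) * lg' + m / \<theta> * lg'"
    by (simp only: distrib_right mult_1 mult.assoc)
  with T_le mlg have T_le: "T \<le> (cT + 1) * (m / \<theta> * lg')" by linarith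
  have \<tau>: "0 \<le> \<tau>" using u T1 by (meson atLeastAtMost_iff order_refl order_trans)
  have C2: "1 \<le> C2" using a c by (simp add: C2_def)
  have s: "1 \<le> sqrt m * lg" using m lg mult_mono[of 1 "sqrt m" 1 lg] by simp
  have "fpm_time n m x0 h L R N cv cg T lam u lbar \<le> T * (C2 * (n * m * (sqrt m * lg))) + T * \<tau>"
    unfolding C2_def using N u unfolding lg_def[symmetric]
    by (intro fpm_time_le[OF _ cost a c s _ lbar T1]) auto
  also have "T * (C2 * (n * m * (sqrt m * lg)))
      \<le> (cT + 1) * (m / \<theta> * ((1 + ln R) * lg)) * (C2 * (n * m * (sqrt m * lg)))"
  proof (intro mult_right_mono)
    have "T \<le> (cT + 1) * (m / \<theta> * lg')" by (rule T_le)
    also have "\<dots> \<le> (cT + 1) * (m / \<theta> * ((1 + ln R) * lg))"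
      using lg'_le cT m \<theta> by (intro mult_left_mono) auto
    finally show "T \<le> (cT + 1) * (m / \<theta> * ((1 + ln R) * lg))" .
  qed (use C2 lg in auto)
  also have "\<dots> = K * (n * m powr 2.5 * (1 / \<theta>) * lg\<^sup>2)"
  proof -
    have "real m powr 2.5 = real m powr (2 + 1 / 2)" by simp
    also have "\<dots> = m * m * sqrt m" using m by (simp only: powr_add) (simp add: powr_half_sqrt power2_eq_square)
    finally show ?thesis by (simp add: K_def power2_eq_square)
  qed
  also have "T * \<tau> \<le> (cT + 1) * (m / \<theta> * lg') * \<tau>" using T_le \<tau> by (intro mult_right_mono)
  also have "\<dots> \<le> (cT + 1) * (m / \<theta> * lg') * \<tau> * ((1 + ln R) * C2)"
    using cT m \<theta> lg \<tau> lnR C2 mult_mono[of 1 "1 + ln R" 1 C2] by (intro le_mult_of_one_le) auto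
  also have "\<dots> = K * (\<tau> * m * (1 / \<theta>) * lg')" by (simp add: K_def mult_ac)
  finally show ?thesis
    unfolding K_def C2_def lg_def lg'_def by (simp add: distrib_left)
qed

end

section \<open>Dimension-free constants, and the guarantee and running time derived from
  them\<close>

theorem theorem3p2:
  fixes L G H R B c0 E :: real
  assumes "0 < G" and "0 < H" and "1 \<le> R" and "0 < B" and "0 < c0" and "0 < E"
  shows "\<exists>cI>0. \<exists>cT>0. \<exists>C>0.
    \<forall>(n::nat) (m::nat) (x0::vec) (h::nat \<Rightarrow> vec \<Rightarrow> real)
      (cv::nat \<Rightarrow> vec \<Rightarrow> real) (cg::nat \<Rightarrow> vec \<Rightarrow> real) (\<tau>CP::nat \<Rightarrow> real) (\<theta>::real) (\<epsilon>::real) N T.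
      projection_problem n m x0 h L G H R B \<longrightarrow>
      eval_cost n m c0 cv cg \<longrightarrow>
      0 < \<epsilon> \<longrightarrow> \<epsilon> \<le> E \<longrightarrow>
      N = agd_iters cI m L B (\<epsilon> ^ 4 / (256 * (m * R * G) ^ 6)) \<longrightarrow>
      T = nat \<lceil>cT * (m / \<theta>) * logO (m * R / \<epsilon>)\<rceil> \<longrightarrow>
      (\<forall>l\<in>nonneg m. approx_minimizer n m x0 h (\<epsilon> ^ 4 / (256 * (m * R * G) ^ 6)) l
                       (oracle_x n m x0 h L N l)) \<and>
      (\<forall>M lam lbar xbar (u::nat \<Rightarrow> real).
        fpm_run m R (fpm_cut n m x0 h L R N) T M lam \<longrightarrow>
        cp_rate m (fpm_cut n m x0 h L R N) T M lam \<theta> \<longrightarrow>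
        (\<forall>t\<in>{1..T}. 0 \<le> u t \<and> u t \<le> \<tau>CP m) \<longrightarrow>
        fpm_output m R (oracle_v n m x0 h L N) T lam lbar \<longrightarrow>
        xbar = oracle_x n m x0 h L N lbar \<longrightarrow>
        (\<forall>x\<in>feasible n m h. (norm (xbar - x0))\<^sup>2 \<le> (norm (x - x0))\<^sup>2 + 6 * \<epsilon>) \<and>
        (\<forall>i<m. h i xbar \<le> \<epsilon>) \<and>
        fpm_time n m x0 h L R N cv cg T lam u lbar
          \<le> C * (n * m powr 2.5 * (1 / \<theta>) * (logO (m / \<epsilon>))\<^sup>2
                  + \<tau>CP m * m * (1 / \<theta>) * logO (m * R / \<epsilon>)))"
proof (cases "L < 0")
  case True
  \<comment> \<open>The constants are chosen before any problem is given, so the sign of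
    \<open>L\<close> is not known yet; a negative \<open>L\<close> admits no problem.\<close>
  then have none: "\<not> projection_problem n m x0 h L G H R B" for n m x0 h
    using projection_setting.L_nonneg[of n m x0 h L G H R B] by (auto simp: projection_setting_def)
  show ?thesis by (intro exI[of _ "1 :: real"] conjI zero_less_one) (simp add: none)
next
  case False
  then have L: "0 \<le> L" by simp
  have G: "0 < G" and H: "0 < H" and R: "1 \<le> R" and B: "0 < B" and c0: "0 < c0" and E: "0 < E"
    using assms by auto
  \<comment> \<open>Bounds the prescribed accuracy uniformly in \<open>m\<close>, as
    \<open>m * R \<ge> 1\<close> and \<open>\<epsilon> \<le> E\<close>.\<close>
  define e0 where "e0 = E ^ 4 / (256 * G ^ 6)"
  define P where "P = G + L * E + 2 * B + E + 1"
  \<comment> \<open>The quotient makes \<open>6 * (c * e)\<close> at most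
    \<open>(\<epsilon> / P)\<^sup>2\<close>, spending two powers of \<open>\<epsilon>\<close>
    against \<open>E\<^sup>2\<close>; the minimum with 1 preserves the prescribed accuracy.\<close>
  define c where "c = min 1 (256 * G ^ 6 / (6 * E\<^sup>2 * P\<^sup>2))"
  define K where "K = B\<^sup>2 + R * (H + G * B) + (R * G)\<^sup>2 / 4"
  \<comment> \<open>\<open>K\<close> bounds the range of the dual over the box per
    \<open>m\<^sup>2\<close>; adding \<open>c * e0\<close> keeps the shrink factor
    \<open>\<delta>\<close> at most 1.\<close>
  define A where "A = K + c * e0"
  define cI where "cI = 2 + \<bar>ln (e0 * G\<^sup>2 / (B\<^sup>2 * L\<^sup>2 * c))\<bar>"
  define cT where "cT = 9 + \<bar>ln (E ^ 4 * (256 * (R * G) ^ 6 * A / c))\<bar>"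
  define a where
    "a = cI * sqrt (2 + R * L) * (8 + \<bar>ln ((2 + R * L) * B * 256 * (R * G) ^ 6)\<bar> + 3 * \<bar>ln E\<bar>) + 1"
  define C where "C = (cT + 1) * (1 + ln R) * (2 * (22 + a * (c0 + 9)) + c0 + 10)"
  have e0: "0 < e0" using E G by (simp add: e0_def)
  have P: "0 < P" using G L E B by (simp add: P_def add_pos_nonneg)
  have c: "0 < c" "c \<le> 1" "c \<le> 256 * G ^ 6 / (6 * E\<^sup>2 * P\<^sup>2)" using G E P by (auto simp: c_def)
  have K: "0 < K" using B R H G by (simp add: K_def add_pos_nonneg)
  have A: "0 < A" "K \<le> A" "c * e0 \<le> A" using K c e0 by (auto simp: A_def add_pos_nonneg)
  have cI: "0 < cI" and cT: "0 < cT" by (simp_all add: cI_def cT_def)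
  have a: "0 \<le> a" using cI R L by (simp add: a_def)
  have C: "0 < C"
    unfolding C_def using cT R a c0 by (intro mult_pos_pos add_nonneg_pos add_pos_nonneg) auto
  show ?thesis
  proof (rule exI[of _ cI], rule conjI[OF cI], rule exI[of _ cT], rule conjI[OF cT],
      rule exI[of _ C], rule conjI[OF C], intro allI impI)
    fix n m :: nat and x0 :: vec and h :: "nat \<Rightarrow> vec \<Rightarrow> real"
      and cv cg :: "nat \<Rightarrow> vec \<Rightarrow> real" and \<tau>CP :: "nat \<Rightarrow> real" and \<theta> \<epsilon> :: real and N T
    assume "projection_problem n m x0 h L G H R B"
      and cost: "eval_cost n m c0 cv cg" and \<epsilon>: "0 < \<epsilon>" "\<epsilon> \<le> E"
      and N: "N = agd_iters cI m L B (\<epsilon> ^ 4 / (256 * (m * R * G) ^ 6))"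
      and T: "T = nat \<lceil>cT * (m / \<theta>) * logO (m * R / \<epsilon>)\<rceil>"
    then interpret projection_setting n m x0 h L G H R B by unfold_locales
    define e where "e = \<epsilon> ^ 4 / (256 * (m * R * G) ^ 6)"
    have m: "1 \<le> real m" using m_pos by simp
    have mRG: "G \<le> m * R * G"
    proof -
      have "1 \<le> m * R" using m R mult_mono[of 1 "real m" 1 R] by simp
      then show ?thesis using G by simp
    qed
    have e: "0 < e" using \<epsilon> m R G by (simp add: e_def)
    have e_le: "e \<le> \<epsilon> ^ 4 / (256 * G ^ 6)"
      unfolding e_def using mRG G \<epsilon> m R
      by (intro divide_left_mono mult_left_mono power_mono mult_pos_pos zero_less_power) auto
    also have "\<dots> \<le> e0"
      unfolding e0_def using \<epsilon> G by (intro divide_right_mono power_mono) auto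
    finally have e_e0: "e \<le> e0" .
    have acc: "lagr m x0 h (oracle_x n m x0 h L N l) l \<le> lagr m x0 h z l + c * e"
      if "l \<in> nonneg m" "z \<in> Rn n" for l z
      using agd_accuracy[OF that B G c(1) e e_e0] unfolding N e_def cI_def .
    have ce: "c * e \<le> e" using c e by simp
    have small: "6 * (c * e) \<le> (\<epsilon> / P)\<^sup>2"
    proof -
      have "c * e \<le> 256 * G ^ 6 / (6 * E\<^sup>2 * P\<^sup>2) * (\<epsilon> ^ 4 / (256 * G ^ 6))"
        using c e_le e G E P by (intro mult_mono) auto
      also have "\<dots> = \<epsilon>\<^sup>2 / (6 * E\<^sup>2 * P\<^sup>2) * \<epsilon>\<^sup>2"
        using G by (simp flip: power_add)
      also have "\<dots> \<le> \<epsilon>\<^sup>2 / (6 * E\<^sup>2 * P\<^sup>2) * E\<^sup>2"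
        using \<epsilon> by (intro mult_left_mono power_mono) auto
      finally show ?thesis using E by (simp add: power_divide)
    qed
    show "(\<forall>l\<in>nonneg m. approx_minimizer n m x0 h (\<epsilon> ^ 4 / (256 * (m * R * G) ^ 6)) l
                       (oracle_x n m x0 h L N l)) \<and>
      (\<forall>M lam lbar xbar (u::nat \<Rightarrow> real).
        fpm_run m R (fpm_cut n m x0 h L R N) T M lam \<longrightarrow>
        cp_rate m (fpm_cut n m x0 h L R N) T M lam \<theta> \<longrightarrow>
        (\<forall>t\<in>{1..T}. 0 \<le> u t \<and> u t \<le> \<tau>CP m) \<longrightarrow>
        fpm_output m R (oracle_v n m x0 h L N) T lam lbar \<longrightarrow>
        xbar = oracle_x n m x0 h L N lbar \<longrightarrow>
        (\<forall>x\<in>feasible n m h. (norm (xbar - x0))\<^sup>2 \<le> (norm (x - x0))\<^sup>2 + 6 * \<epsilon>) \<and>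
        (\<forall>i<m. h i xbar \<le> \<epsilon>) \<and>
        fpm_time n m x0 h L R N cv cg T lam u lbar
          \<le> C * (n * m powr 2.5 * (1 / \<theta>) * (logO (m / \<epsilon>))\<^sup>2
                  + \<tau>CP m * m * (1 / \<theta>) * logO (m * R / \<epsilon>)))"
    proof (intro conjI[of "\<forall>l\<in>nonneg m. _ l"] allI impI ballI)
      fix l assume "l \<in> nonneg m"
      then show "approx_minimizer n m x0 h (\<epsilon> ^ 4 / (256 * (m * R * G) ^ 6)) l (oracle_x n m x0 h L N l)"
        using acc ce unfolding approx_minimizer_def e_def[symmetric] by (force simp: oracle_x_in)
    next
      fix M lam lbar xbar and u :: "nat \<Rightarrow> real"
      assume run: "fpm_run m R (fpm_cut n m x0 h L R N) T M lam"
        and rate: "cp_rate m (fpm_cut n m x0 h L R N) T M lam \<theta>"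
        and u: "\<forall>t\<in>{1..T}. 0 \<le> u t \<and> u t \<le> \<tau>CP m"
        and out: "fpm_output m R (oracle_v n m x0 h L N) T lam lbar"
        and xbar: "xbar = oracle_x n m x0 h L N lbar"
      have \<theta>: "0 < \<theta>" "\<theta> \<le> ln 2" using rate by (auto simp: cp_rate_def)
      have lbar: "lbar \<in> box m R" using out by (auto simp: fpm_output_def is_arg_max_def)
      then have lbar_nn: "lbar \<in> nonneg m" by (auto simp: box_def nonneg_def)
      obtain ls xs where ls: "ls \<in> box m R" and xs: "xs \<in> \<K>" "dualf ls = (norm (xs - x0))\<^sup>2"
        "\<And>x. x \<in> \<K> \<Longrightarrow> (norm (xs - x0))\<^sup>2 \<le> (norm (x - x0))\<^sup>2" "norm (xs - x0) \<le> B"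
        using strong_duality by metis
      define \<delta> where "\<delta> = c * e / (A * (real m)\<^sup>2)"
      have Am: "A \<le> A * (real m)\<^sup>2" using A m by simp
      have \<delta>: "0 < \<delta>" "\<delta> \<le> 1"
      proof -
        show "0 < \<delta>" using c e A m by (simp add: \<delta>_def)
        have "c * e \<le> c * e0" using c e_e0 by simp
        then have "c * e \<le> A * (real m)\<^sup>2" using A Am by linarith
        then show "\<delta> \<le> 1" using A m by (simp add: \<delta>_def)
      qed
      have gap: "\<delta> * (dualf ls - dualf \<mu>) \<le> c * e" if "\<mu> \<in> box m R" for \<mu>
      proof -
        have "dualf ls - dualf \<mu> \<le> K * (real m)\<^sup>2"
          unfolding K_def using dual_gap_le[OF R _ B _ that xs(2,4)] H G by simp
        also have "\<dots> \<le> A * (real m)\<^sup>2" using A by (intro mult_right_mono) auto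
        finally have "\<delta> * (dualf ls - dualf \<mu>) \<le> \<delta> * (A * (real m)\<^sup>2)"
          using \<delta> by (intro mult_left_mono) auto
        also have "\<dots> = c * e" using A m by (simp add: \<delta>_def)
        finally show ?thesis .
      qed
      have "exp (- \<theta> * T) < \<delta> ^ m"
        unfolding \<delta>_def e_def
        by (rule exp_rounds_less[OF R G c(1) A(1) \<epsilon> \<theta>(1)]) (simp only: T cT_def real_nat_ceiling_ge)
      then have "dualf ls \<le> dualf lbar + 2 * (c * e)"
        using c e R by (intro cutting_plane_dual_gap[OF _ ls run rate out acc \<delta> _ gap]) auto
      moreover have "lagr m x0 h xbar lbar - c * e \<le> dualf lbar"
        unfolding xbar using acc[OF lbar_nn] by (intro dual_geI) (simp add: diff_le_eq)
      ultimately have "(norm (xbar - xs))\<^sup>2 \<le> 6 * (c * e)"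
        using near_dual_optimal_imp_near_optimal[OF lbar_nn _ xs(1), of xbar "c * e"] xs(2)
        by (simp add: xbar oracle_x_in)
      then have "(norm (xbar - xs))\<^sup>2 \<le> (\<epsilon> / P)\<^sup>2" using small by linarith
      then have "(\<forall>x\<in>\<K>. (norm (xbar - x0))\<^sup>2 \<le> (norm (x - x0))\<^sup>2 + 6 * \<epsilon>)" "\<forall>i<m. h i xbar \<le> \<epsilon>"
        using near_optimal_imp_guarantee[of xbar xs \<epsilon> E] xs G \<epsilon>
        unfolding P_def xbar by (simp_all add: oracle_x_in)
      moreover have "fpm_time n m x0 h L R N cv cg T lam u lbar
          \<le> C * (n * m powr 2.5 * (1 / \<theta>) * (logO (m / \<epsilon>))\<^sup>2
                  + \<tau>CP m * m * (1 / \<theta>) * logO (m * R / \<epsilon>))"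
        unfolding C_def
      proof (rule running_time[OF _ cost a _ cT R \<epsilon>(1) \<theta> T u lbar])
        show "N l \<le> a * (sqrt m * logO (m / \<epsilon>))" if "l \<in> box m R" for l
          unfolding N a_def by (rule agd_iters_le[OF R B G cI \<epsilon> that])
      qed (use c0 in simp)
      ultimately show "(\<forall>x\<in>feasible n m h. (norm (xbar - x0))\<^sup>2 \<le> (norm (x - x0))\<^sup>2 + 6 * \<epsilon>) \<and>
        (\<forall>i<m. h i xbar \<le> \<epsilon>) \<and>
        fpm_time n m x0 h L R N cv cg T lam u lbar
          \<le> C * (n * m powr 2.5 * (1 / \<theta>) * (logO (m / \<epsilon>))\<^sup>2
                  + \<tau>CP m * m * (1 / \<theta>) * logO (m * R / \<epsilon>))"
        by blast
    qed
  qed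
qed

end
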